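(* Let $\rho$ be a probability distribution on $\mathcal S$ and $f_\rho(\pi)=\mathbb E_{s\sim\rho}[V^\pi_r(s)]$. At any policy $\pi\in\mathrm{ReInt}(\Pi)$ (the relative interior of $\Pi$), except for a set of zero $(|\mathcal A|-1)|\mathcal S|$-dimensional Hausdorff measure, $f_\rho$ is differentiable (in the sense of the context) and its policy gradient is given by $$\nabla f_\rho(\pi)[s,a]=\frac{1}{1-\gamma}\,d_\rho^{\pi,u_\pi}(s)\,Q^\pi_{u_\pi}(s,a),\qquad\forall(s,a)\in\mathcal S\times\mathcal A .$$
   Context: Robust MDP. $\mathcal S,\mathcal A$ are finite nonempty state and action sets, $c:\mathcal S\times\mathcal A\to\mathbb R$ is a cost with $0<c(s,a)\le1$, $\gamma\in(0,1)$ is the discount factor, and $\mathbb P_{N}$ is a nominal transition kernel ($\mathbb P_N(\cdot|s,a)\in\Delta_{\mathcal S}$, the probability simplex). The uncertainty set $\mathcal U\subset\mathbb R^{|\mathcal S|\times|\mathcal S|\times|\mathcal A|}$ is nonempty, compact and $(s,a)$-rectangular: $\mathcal U=\prod_{s,a}\mathcal U_{s,a}$ with $\mathcal U_{s,a}=\{u(\cdot|s,a):u\in\mathcal U\}$; for every $u\in\mathcal U$, $\mathbb P_u(\cdot|s,a)=\mathbb P_N(\cdot|s,a)+u(\cdot|s,a)$ is a transition kernel. $\Pi\subset\mathbb R^{|\mathcal S||\mathcal A|}$ is the set of stationary randomized policies ($\pi(\cdot|s)\in\Delta_{\mathcal A}$ for all $s$). $V^\pi_u(s)=\mathbb E[\sum_{t\ge0}\gamma^t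 c(s_t,a_t)\mid s_0=s]$ with $a_t\sim\pi(\cdot|s_t)$, $s_{t+1}\sim\mathbb P_u(\cdot|s_t,a_t)$; $Q^\pi_u(s,a)$ is the same with in addition $a_0=a$; $V^\pi_r(s)=\max_{u\in\mathcal U}V^\pi_u(s)$. $u_\pi\in\mathcal U$ denotes a worst-case uncertainty of $\pi$: $u_\pi(\cdot|s,a)\in\operatorname{Argmax}_{u(\cdot|s,a)\in\mathcal U_{s,a}}\sum_{s'}\mathbb P_u(s'|s,a)V^\pi_r(s')$ for all $(s,a)$ (if not unique, one is chosen by an arbitrary deterministic rule). $d^{\pi,u}_s(s')=(1-\gamma)\sum_{t\ge0}\gamma^t\Pr(s_t=s'\mid s_0=s)$ under policy $\pi$ and kernel $\mathbb P_u$; $d^{\pi,u}_\rho(s')=\mathbb E_{s\sim\rho}d^{\pi,u}_s(s')$. Differentiability (direct parameterization). A function $f:\Pi\to\mathbb R$ is differentiable at $\pi\in\Pi$ with policy gradient $\nabla f(\pi)\in\mathbb R^{|\mathcal S||\mathcal A|}$ if $$\lim_{\delta\to0,\ \pi+\delta\in\Pi}\ \frac{|f(\pi+\delta)-f(\pi)-\langle\nabla f(\pi),\delta\rangle|}{\|\delta\|_2}=0 ;$$ "the policy gradient is given by $g$" means that $\nabla f(\pi)=g$ satisfies this condition. *)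

theory Defs
  imports "HOL-Probability.Probability"
begin

section \<open>Policies, kernels and trajectories\<close>

definition prob_simplex :: "(real ^ 'n) set" where
  "prob_simplex = {x. (\<forall>i. 0 \<le> x $ i) \<and> (\<Sum>i\<in>UNIV. x $ i) = 1}"

text \<open>A policy is read as \<open>\<pi> $ s $ a\<close>, the probability of action \<open>a\<close> in state \<open>s\<close>; kernels and
  uncertainties are read as \<open>P $ s $ a $ s'\<close>.\<close>

definition policies :: "(real ^ 'a ^ 's) set" where
  "policies = {\<pi>. \<forall>s. \<pi> $ s \<in> prob_simplex}"

definition kernels :: "(real ^ 's ^ 'a ^ 's) set" where
  "kernels = {P. \<forall>s a. P $ s $ a \<in> prob_simplex}"

text \<open>Only meaningful for \<open>x \<in> prob_simplex\<close>, where \<open>pmf (vec_pmf x) i = x $ i\<close>.\<close>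

definition vec_pmf :: "real ^ 'n \<Rightarrow> 'n pmf" where
  "vec_pmf x = embed_pmf (\<lambda>i. x $ i)"

lemma pmf_vec_pmf:
  fixes x :: "real ^ 'n"
  assumes "x \<in> prob_simplex"
  shows "pmf (vec_pmf x) i = x $ i"
  unfolding vec_pmf_def using assms
  by (subst pmf_embed_pmf)
     (auto simp: prob_simplex_def nn_integral_count_space_finite sum_ennreal)

definition step_pmf :: "real ^ 's ^ 'a ^ 's \<Rightarrow> real ^ 'a ^ 's \<Rightarrow> 's \<times> 'a \<Rightarrow> ('s \<times> 'a) pmf" where
  "step_pmf P \<pi> = (\<lambda>(s, a). bind_pmf (vec_pmf (P $ s $ a)) (\<lambda>s'. map_pmf (Pair s') (vec_pmf (\<pi> $ s'))))"

text \<open>The law of the \<open>n\<close>-th state-action pair given the pairs at the times \<open>0, \<dots>, n - 1\<close>; the pair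
  at time \<open>0\<close> has law \<open>\<mu>\<close>.\<close>

definition traj_step ::
  "real ^ 's ^ 'a ^ 's \<Rightarrow> real ^ 'a ^ 's \<Rightarrow> ('s \<times> 'a) pmf \<Rightarrow> nat \<Rightarrow> (nat \<Rightarrow> 's \<times> 'a) \<Rightarrow> ('s \<times> 'a) measure"
  where
  "traj_step P \<pi> \<mu> n \<omega> = measure_pmf (case n of 0 \<Rightarrow> \<mu> | Suc m \<Rightarrow> step_pmf P \<pi> (\<omega> m))"

lemma Ionescu_Tulcea_traj_step:
  fixes P :: "real ^ 's::finite ^ 'a::finite ^ 's"
  shows "Ionescu_Tulcea (traj_step P \<pi> \<mu>) (\<lambda>_. count_space UNIV)"
proof (rule Ionescu_Tulcea.intro)
  fix n
  show "traj_step P \<pi> \<mu> n \<in> PiM {0..<n} (\<lambda>_. count_space UNIV) \<rightarrow>\<^sub>M subprob_algebra (count_space UNIV)"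
  proof (cases n)
    case 0
    then show ?thesis
      by (simp add: traj_step_def[abs_def] space_subprob_algebra prob_space_imp_subprob_space
          measure_pmf.prob_space_axioms)
  next
    case (Suc m)
    have *: "(\<lambda>\<omega>. \<omega> m) \<in> PiM {0..<n} (\<lambda>_. count_space UNIV) \<rightarrow>\<^sub>M (count_space UNIV :: ('s \<times> 'a) measure)"
      by (rule measurable_component_singleton) (simp add: Suc)
    have "(\<lambda>x. measure_pmf (step_pmf P \<pi> x)) \<in> count_space UNIV \<rightarrow>\<^sub>M subprob_algebra (count_space UNIV)"
      by (auto simp: space_subprob_algebra prob_space_imp_subprob_space measure_pmf.prob_space_axioms)
    from measurable_compose[OF * this] show ?thesis
      by (simp add: traj_step_def[abs_def] Suc)
  qed
next
  show "prob_space (traj_step P \<pi> \<mu> n \<omega>)" for n \<omega>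
    by (simp add: traj_step_def measure_pmf.prob_space_axioms)
qed

text \<open>The law of the whole trajectory \<open>(s\<^sub>t, a\<^sub>t)\<^sub>t\<close>, i.e. the Ionescu-Tulcea extension.\<close>

definition traj ::
  "real ^ 's ^ 'a ^ 's \<Rightarrow> real ^ 'a ^ 's \<Rightarrow> ('s \<times> 'a) pmf \<Rightarrow> (nat \<Rightarrow> 's \<times> 'a) measure" where
  "traj P \<pi> \<mu> = projective_family.lim UNIV
     (Ionescu_Tulcea.CI (traj_step P \<pi> \<mu>) (\<lambda>_. count_space UNIV)) (\<lambda>_. count_space UNIV)"

text \<open>The trajectory conditioned on \<open>s\<^sub>0 = s\<close>.\<close>

abbreviation traj_from ::
  "real ^ 's ^ 'a ^ 's \<Rightarrow> real ^ 'a ^ 's \<Rightarrow> 's \<Rightarrow> (nat \<Rightarrow> 's \<times> 'a) measure" where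
  "traj_from P \<pi> s \<equiv> traj P \<pi> (map_pmf (Pair s) (vec_pmf (\<pi> $ s)))"

section \<open>Value functions and occupancy measures\<close>

definition discounted_cost :: "('s \<Rightarrow> 'a \<Rightarrow> real) \<Rightarrow> real \<Rightarrow> (nat \<Rightarrow> 's \<times> 'a) \<Rightarrow> real" where
  "discounted_cost c \<gamma> \<omega> = (\<Sum>t. \<gamma> ^ t * c (fst (\<omega> t)) (snd (\<omega> t)))"

definition V_fun ::
  "('s \<Rightarrow> 'a \<Rightarrow> real) \<Rightarrow> real \<Rightarrow> real ^ 's ^ 'a ^ 's \<Rightarrow> real ^ 'a ^ 's \<Rightarrow> 's \<Rightarrow> real" where
  "V_fun c \<gamma> P \<pi> s = (\<integral>\<omega>. discounted_cost c \<gamma> \<omega> \<partial>traj_from P \<pi> s)"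

definition Q_fun ::
  "('s \<Rightarrow> 'a \<Rightarrow> real) \<Rightarrow> real \<Rightarrow> real ^ 's ^ 'a ^ 's \<Rightarrow> real ^ 'a ^ 's \<Rightarrow> 's \<Rightarrow> 'a \<Rightarrow> real" where
  "Q_fun c \<gamma> P \<pi> s a = (\<integral>\<omega>. discounted_cost c \<gamma> \<omega> \<partial>traj P \<pi> (return_pmf (s, a)))"

definition occupancy ::
  "real \<Rightarrow> real ^ 's ^ 'a ^ 's \<Rightarrow> real ^ 'a ^ 's \<Rightarrow> 's \<Rightarrow> 's \<Rightarrow> real" where
  "occupancy \<gamma> P \<pi> s s' =
     (1 - \<gamma>) * (\<Sum>t. \<gamma> ^ t * measure (traj_from P \<pi> s) {\<omega>. fst (\<omega> t) = s'})"

definition occupancy_from ::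
  "real \<Rightarrow> real ^ 's ^ 'a ^ 's \<Rightarrow> real ^ 'a ^ 's \<Rightarrow> 's pmf \<Rightarrow> 's \<Rightarrow> real" where
  "occupancy_from \<gamma> P \<pi> \<rho> s' = measure_pmf.expectation \<rho> (\<lambda>s. occupancy \<gamma> P \<pi> s s')"

section \<open>Uncertainty sets and robust values\<close>

definition sa_section :: "(real ^ 's ^ 'a ^ 's) set \<Rightarrow> 's \<Rightarrow> 'a \<Rightarrow> (real ^ 's) set" where
  "sa_section U s a = (\<lambda>u. u $ s $ a) ` U"

definition sa_rectangular :: "(real ^ 's ^ 'a ^ 's) set \<Rightarrow> bool" where
  "sa_rectangular U \<longleftrightarrow> U = {u. \<forall>s a. u $ s $ a \<in> sa_section U s a}"

text \<open>The supremum is a maximum for nonempty compact \<open>U\<close>, as the value is continuous in the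
  kernel.\<close>

definition V_robust ::
  "('s \<Rightarrow> 'a \<Rightarrow> real) \<Rightarrow> real \<Rightarrow> real ^ 's ^ 'a ^ 's \<Rightarrow> (real ^ 's ^ 'a ^ 's) set
     \<Rightarrow> real ^ 'a ^ 's \<Rightarrow> 's \<Rightarrow> real" where
  "V_robust c \<gamma> P\<^sub>N U \<pi> s = (SUP u\<in>U. V_fun c \<gamma> (P\<^sub>N + u) \<pi> s)"

definition worst_case ::
  "('s \<Rightarrow> 'a \<Rightarrow> real) \<Rightarrow> real \<Rightarrow> real ^ 's ^ 'a ^ 's \<Rightarrow> (real ^ 's ^ 'a ^ 's) set
     \<Rightarrow> real ^ 'a ^ 's \<Rightarrow> real ^ 's ^ 'a ^ 's \<Rightarrow> bool" where
  "worst_case c \<gamma> P\<^sub>N U \<pi> u \<longleftrightarrow> u \<in> U \<and>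
     (\<forall>s a. is_arg_max (\<lambda>v. \<Sum>s'\<in>UNIV. (P\<^sub>N $ s $ a $ s' + v $ s') * V_robust c \<gamma> P\<^sub>N U \<pi> s')
              (\<lambda>v. v \<in> sa_section U s a) (u $ s $ a))"

section \<open>Policy gradients\<close>

text \<open>Only the values of \<open>f\<close> on \<open>policies\<close> matter. The inner product and norm are the Euclidean
  ones on \<open>\<real>\<^bsup>|S||A|\<^esup>\<close>. Since \<open>\<delta>\<close> is restricted to differences of policies, \<open>g\<close> is not unique.\<close>

definition has_policy_gradient ::
  "(real ^ 'a ^ 's \<Rightarrow> real) \<Rightarrow> real ^ 'a ^ 's \<Rightarrow> real ^ 'a ^ 's \<Rightarrow> bool" where
  "has_policy_gradient f g \<pi> \<longleftrightarrow>
     ((\<lambda>\<delta>. \<bar>f (\<pi> + \<delta>) - f \<pi> - g \<bullet> \<delta>\<bar> / norm \<delta>) \<longlongrightarrow> 0) (at 0 within {\<delta>. \<pi> + \<delta> \<in> policies})"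

section \<open>Hausdorff measure\<close>

text \<open>The \<open>d\<close>-dimensional Hausdorff outer measure for integral \<open>d\<close>, without the normalising
  constant. For \<open>d = 0\<close> it is the counting measure, because of \<open>0 ^ 0 = 1\<close> and the separate
  treatment of the empty set. Boundedness is required as \<open>diameter\<close> is unspecified on unbounded
  sets.\<close>

definition hausdorff_content :: "nat \<Rightarrow> real \<Rightarrow> 'b::metric_space set \<Rightarrow> ennreal" where
  "hausdorff_content d \<epsilon> X =
     (INF C\<in>{C :: nat \<Rightarrow> 'b set. X \<subseteq> (\<Union>i. C i) \<and> (\<forall>i. bounded (C i) \<and> diameter (C i) \<le> \<epsilon>)}.
        \<Sum>i. if C i = {} then 0 else ennreal (diameter (C i) ^ d))"

definition hausdorff_measure :: "nat \<Rightarrow> 'b::metric_space set \<Rightarrow> ennreal" where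
  "hausdorff_measure d X = (SUP \<epsilon>\<in>{0<..}. hausdorff_content d \<epsilon> X)"

end

theory Submission
  imports Defs
begin

text \<open>Write \<open>F(u, \<pi>)\<close> for the expected value of \<open>\<pi>\<close> under the fixed kernel \<open>P\<^sub>N + u\<close>. A worst case
  \<open>u\<^sub>\<pi>\<close> solves the robust Bellman equation, hence attains all the suprema \<open>V\<^sub>r\<^sup>\<pi>(s)\<close> simultaneously, so
  that the objective is \<open>f(\<pi>) = max\<^sub>u F(u, \<pi>) = F(u\<^sub>\<pi>, \<pi>)\<close>. The performance difference identity gives
  the gradient \<open>G(u, \<pi>)\<close> of \<open>F(u, \<cdot>)\<close> with a quadratic remainder that is uniform in \<open>u\<close> and \<open>\<pi>\<close>. By
  compactness of the uncertainty set (Danskin's argument), \<open>f\<close> is differentiable at \<open>\<pi>\<close> with gradient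
  \<open>G(u\<^sub>\<pi>, \<pi>)\<close> as soon as all maximizers at \<open>\<pi>\<close> have the same gradient along the policy simplex.

  No Rademacher theorem is needed for the exceptional set: the points at which two maximizers have
  slopes \<open>\<le> p\<close> and \<open>\<ge> q > p\<close> along a basis direction form, locally, a Lipschitz graph in that direction,
  and a grid count shows that such a graph is null for the Hausdorff measure of the dimension of the
  policy set. Rational \<open>p < q\<close> and finitely many directions suffice.\<close>

section \<open>Null sets of the Hausdorff measure\<close>

lemma hausdorff_measure_eq_0I:
  assumes "\<And>\<epsilon> \<eta>. 0 < \<epsilon> \<Longrightarrow> 0 < \<eta> \<Longrightarrow> \<exists>C :: nat \<Rightarrow> 'b::metric_space set. X \<subseteq> (\<Union>i. C i) \<and>
    (\<forall>i. bounded (C i) \<and> diameter (C i) \<le> \<epsilon>) \<and>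
    (\<Sum>i. if C i = {} then 0 else ennreal (diameter (C i) ^ d)) \<le> ennreal \<eta>"
  shows "hausdorff_measure d X = 0"
proof -
  have "hausdorff_content d \<epsilon> X \<le> 0" if "0 < \<epsilon>" for \<epsilon>
  proof (rule ennreal_le_epsilon)
    fix \<eta> :: real assume "0 < \<eta>"
    from assms[OF that this] obtain C where C: "X \<subseteq> (\<Union>i. C i)" "\<forall>i::nat. bounded (C i) \<and> diameter (C i) \<le> \<epsilon>"
        "(\<Sum>i. if C i = {} then 0 else ennreal (diameter (C i) ^ d)) \<le> ennreal \<eta>"
      by blast
    then show "hausdorff_content d \<epsilon> X \<le> 0 + ennreal \<eta>"
      unfolding hausdorff_content_def by (intro INF_lower2[of C]) auto
  qed
  then show ?thesis
    unfolding hausdorff_measure_def by (metis SUP_le_iff greaterThan_iff le_zero_eq)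
qed

lemma hausdorff_measure_eq_0D:
  fixes X :: "'b::metric_space set"
  assumes "hausdorff_measure d X = 0" "0 < \<epsilon>" "0 < \<eta>"
  shows "\<exists>C :: nat \<Rightarrow> 'b set. X \<subseteq> (\<Union>i. C i) \<and> (\<forall>i. bounded (C i) \<and> diameter (C i) \<le> \<epsilon>) \<and>
    (\<Sum>i. if C i = {} then 0 else ennreal (diameter (C i) ^ d)) \<le> ennreal \<eta>"
proof -
  have "hausdorff_content d \<epsilon> X \<le> hausdorff_measure d X"
    unfolding hausdorff_measure_def using assms(2) by (intro SUP_upper) auto
  then have "hausdorff_content d \<epsilon> X < ennreal \<eta>"
    using assms by (simp add: order.strict_trans1)
  then show ?thesis
    unfolding hausdorff_content_def INF_less_iff by (auto intro: less_imp_le)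
qed

text \<open>The \<open>n\<close>-th set gets a cover of weight at most
  \<open>\<eta> / 2 ^ (n + 1)\<close>; \<open>prod_decode\<close> merges these covers into one
  sequence of total weight at most \<eta>.\<close>

lemma hausdorff_measure_UN_nat_eq_0:
  fixes X :: "nat \<Rightarrow> 'b::metric_space set"
  assumes null: "\<And>n. hausdorff_measure d (X n) = 0"
  shows "hausdorff_measure d (\<Union>n. X n) = 0"
proof (rule hausdorff_measure_eq_0I)
  fix \<epsilon> \<eta> :: real assume pos: "0 < \<epsilon>" "0 < \<eta>"
  let ?s = "\<lambda>C. if C = {} then 0 else ennreal (diameter C ^ d)"
  have "\<exists>C. X n \<subseteq> (\<Union>i. C i) \<and> (\<forall>i. bounded (C i) \<and> diameter (C i) \<le> \<epsilon>) \<and>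
      (\<Sum>i. ?s (C i)) \<le> ennreal (\<eta> * (1 / 2) ^ Suc n)" for n
    using pos by (intro hausdorff_measure_eq_0D[OF null[of n]]) simp_all
  then have "\<exists>C. \<forall>n. X n \<subseteq> (\<Union>i. C n i) \<and> (\<forall>i. bounded (C n i) \<and> diameter (C n i) \<le> \<epsilon>) \<and>
      (\<Sum>i. ?s (C n i)) \<le> ennreal (\<eta> * (1 / 2) ^ Suc n)"
    by (intro choice allI)
  then obtain C where C: "X n \<subseteq> (\<Union>i. C n i)" "bounded (C n i)" "diameter (C n i) \<le> \<epsilon>"
      "(\<Sum>i. ?s (C n i)) \<le> ennreal (\<eta> * (1 / 2) ^ Suc n)" for n i
    by blast
  let ?D = "\<lambda>j. C (fst (prod_decode j)) (snd (prod_decode j))"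
  have "(\<Union>n. X n) \<subseteq> (\<Union>j. ?D j)"
  proof
    fix x assume "x \<in> (\<Union>n. X n)"
    then obtain n i where "x \<in> C n i"
      using C(1) by blast
    then have "x \<in> ?D (prod_encode (n, i))"
      by simp
    then show "x \<in> (\<Union>j. ?D j)"
      by blast
  qed
  moreover have "(\<Sum>j. ?s (?D j)) \<le> ennreal \<eta>"
  proof -
    have "(\<Sum>j. ?s (?D j)) = (\<Sum>n. \<Sum>i. ?s (C n i))"
      using suminf_ennreal_2dimen[of "\<lambda>n. \<Sum>i. ?s (C n i)" "\<lambda>p. ?s (C (fst p) (snd p))"]
      by (simp cong: if_cong)
    also have "\<dots> \<le> (\<Sum>n. ennreal (\<eta> * (1 / 2) ^ Suc n))"
      using C(4) by (intro suminf_le summableI)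
    also have "\<dots> = ennreal (\<eta> * 1)"
      using pos power_half_series by (intro suminf_ennreal_eq sums_mult) auto
    finally show ?thesis
      by simp
  qed
  ultimately show "\<exists>C. (\<Union>n. X n) \<subseteq> (\<Union>i. C i) \<and> (\<forall>i. bounded (C i) \<and> diameter (C i) \<le> \<epsilon>) \<and>
      (\<Sum>i. ?s (C i)) \<le> ennreal \<eta>"
    using C(2,3) by (intro exI[of _ ?D]) auto
qed

lemma hausdorff_measure_empty [simp]: "hausdorff_measure d {} = 0"
  by (rule hausdorff_measure_eq_0I) (auto intro!: exI[of _ "\<lambda>_. {}"])

lemma hausdorff_measure_UN_eq_0:
  assumes "countable I" "\<And>i. i \<in> I \<Longrightarrow> hausdorff_measure d (X i) = 0"
  shows "hausdorff_measure d (\<Union>i\<in>I. X i) = 0"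
proof (cases "I = {}")
  case False
  then have "(\<Union>i\<in>I. X i) = (\<Union>n. X (from_nat_into I n))"
    using assms(1) by (metis image_image range_from_nat_into)
  then show ?thesis
    using hausdorff_measure_UN_nat_eq_0[of d "\<lambda>n. X (from_nat_into I n)"] assms(2) False
    by (simp add: from_nat_into)
qed simp

text \<open>In dimension \<open>d + 1\<close>, a cover by at most \<open>A n ^ d\<close> pieces of
  diameter at most \<open>R / n\<close> has weight at most \<open>A R ^ (d + 1) / n\<close>, which
  tends to 0.\<close>

lemma hausdorff_measure_eq_0_if_covering_number:
  fixes X :: "'b::metric_space set"
  assumes R: "0 \<le> R" and A: "0 \<le> A"
    and cover: "\<And>n::nat. 0 < n \<Longrightarrow> \<exists>\<C>. finite \<C> \<and> X \<subseteq> \<Union>\<C> \<and> real (card \<C>) \<le> A * real n ^ d \<and>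
      (\<forall>C\<in>\<C>. bounded C \<and> diameter C \<le> R / n)"
  shows "hausdorff_measure (Suc d) X = 0"
proof (rule hausdorff_measure_eq_0I)
  fix \<epsilon> \<eta> :: real assume pos: "0 < \<epsilon>" "0 < \<eta>"
  \<comment> \<open>The first entry of the maximum makes the pieces small enough, the second makes
    their total weight at most \<eta>; the summand 1 keeps \<open>n\<close> positive.\<close>
  define n where "n = nat \<lceil>max (R / \<epsilon>) (A * R ^ Suc d / \<eta>)\<rceil> + 1"
  have n: "0 < n"
    by (simp add: n_def)
  have "max (R / \<epsilon>) (A * R ^ Suc d / \<eta>) \<le> n"
    unfolding n_def by linarith
  then have R_n: "R / n \<le> \<epsilon>" and A_n: "A * R ^ Suc d / n \<le> \<eta>"
    using pos n by (auto simp: field_simps)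
  obtain \<C> where \<C>: "finite \<C>" "X \<subseteq> \<Union>\<C>" "real (card \<C>) \<le> A * real n ^ d"
      "\<And>C. C \<in> \<C> \<Longrightarrow> bounded C \<and> diameter C \<le> R / n"
    using cover[OF n] by blast
  obtain f where f: "bij_betw f {..<card \<C>} \<C>"
    using \<C>(1) finite_same_card_bij[of "{..<card \<C>}" \<C>] by auto
  \<comment> \<open>Padding with empty sets turns the finite cover into a sequence without adding
    weight.\<close>
  define C where "C i = (if i < card \<C> then f i else {})" for i
  have C_bound: "bounded (C i) \<and> diameter (C i) \<le> R / n" for i
    using f \<C>(4) R by (auto simp: C_def bij_betw_def)
  have "(\<Sum>i. if C i = {} then 0 else ennreal (diameter (C i) ^ Suc d)) =
      (\<Sum>i<card \<C>. if C i = {} then 0 else ennreal (diameter (C i) ^ Suc d))"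
    by (rule suminf_finite) (auto simp: C_def)
  also have "\<dots> \<le> (\<Sum>i<card \<C>. ennreal ((R / n) ^ Suc d))"
    using C_bound by (intro sum_mono) (auto intro!: ennreal_leI power_mono mult_mono diameter_ge_0 simp del: power_Suc)
  also have "\<dots> = ennreal (card \<C> * (R / n) ^ Suc d)"
    using R by (simp add: ennreal_of_nat_eq_real_of_nat ennreal_mult[symmetric] del: power_Suc)
  also have "\<dots> \<le> ennreal \<eta>"
  proof (rule ennreal_leI)
    have "card \<C> * (R / n) ^ Suc d \<le> A * n ^ d * (R / n) ^ Suc d"
      using \<C>(3) R by (intro mult_right_mono) auto
    also have "\<dots> = A * R ^ Suc d / n"
      using n by (simp add: power_divide)
    also note A_n
    finally show "card \<C> * (R / n) ^ Suc d \<le> \<eta>" .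
  qed
  finally have "(\<Sum>i. if C i = {} then 0 else ennreal (diameter (C i) ^ Suc d)) \<le> ennreal \<eta>" .
  moreover have "X \<subseteq> (\<Union>i. C i)"
  proof
    fix x assume "x \<in> X"
    then obtain S where "S \<in> \<C>" "x \<in> S"
      using \<C>(2) by blast
    then obtain i where "i < card \<C>" "f i = S"
      using f by (metis bij_betw_def imageE lessThan_iff)
    then show "x \<in> (\<Union>i. C i)"
      using \<open>x \<in> S\<close> by (auto simp: C_def)
  qed
  ultimately show "\<exists>C. X \<subseteq> (\<Union>i. C i) \<and> (\<forall>i. bounded (C i) \<and> diameter (C i) \<le> \<epsilon>) \<and>
      (\<Sum>i. if C i = {} then 0 else ennreal (diameter (C i) ^ Suc d)) \<le> ennreal \<eta>"
    using C_bound R_n by (intro exI[of _ C]) (meson order_trans)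
qed

text \<open>The coordinate along \<open>b\<close> is controlled by the other \<open>d - 1\<close>
  ones. A grid of mesh \<open>1 / n\<close> in those coordinates meets \<open>X\<close> in at most
  of the order of \<open>n ^ (d - 1)\<close> cells, each of diameter of order
  \<open>1 / n\<close>.\<close>

lemma hausdorff_measure_lipschitz_graph:
  fixes X :: "'b::real_inner set"
  assumes B: "finite B" "card B = d" "b \<in> B" and "bounded X" and C: "0 \<le> C"
    and graph: "\<And>x y. x \<in> X \<Longrightarrow> y \<in> X \<Longrightarrow> norm (y - x) \<le> C * (\<Sum>b'\<in>B - {b}. \<bar>(y - x) \<bullet> b'\<bar>)"
  shows "hausdorff_measure d X = 0"
proof -
  let ?B = "B - {b}"
  obtain e where d: "d = Suc e" and card: "card ?B = e"
    using B by (metis card_Suc_Diff1)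
  obtain M0 where M0: "\<And>x. x \<in> X \<Longrightarrow> norm x \<le> M0"
    using \<open>bounded X\<close> by (auto simp: bounded_iff)
  \<comment> \<open>\<open>M\<close> bounds all coordinates on \<open>X\<close>; as it is at least
    1, the \<open>2 * M * n + 1\<close> floor values per coordinate are at most
    \<open>3 * M * n\<close>.\<close>
  define M where "M = nat \<lceil>M0 * (\<Sum>b'\<in>B. norm b')\<rceil> + 1"
  have M: "\<bar>x \<bullet> b'\<bar> \<le> M" if "x \<in> X" "b' \<in> B" for x b'
  proof -
    have "\<bar>x \<bullet> b'\<bar> \<le> norm x * norm b'"
      by (rule Cauchy_Schwarz_ineq2)
    also have "\<dots> \<le> M0 * (\<Sum>b'\<in>B. norm b')"
      using that M0 B by (intro mult_mono member_le_sum) (auto intro: order_trans[OF norm_ge_zero])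
    also have "\<dots> \<le> M"
      unfolding M_def by linarith
    finally show ?thesis .
  qed
  show ?thesis
    unfolding d
  proof (rule hausdorff_measure_eq_0_if_covering_number)
    fix n :: nat assume n: "0 < n"
    define cell where "cell k = {x \<in> X. \<forall>b'\<in>?B. \<lfloor>n * (x \<bullet> b')\<rfloor> = k b'}" for k
    define K where "K = (\<Pi>\<^sub>E b'\<in>?B. {- int (M * n)..int (M * n)})"
    have "finite K"
      unfolding K_def using B by (intro finite_PiE) auto
    moreover have "X \<subseteq> \<Union>(cell ` K)"
    proof
      fix x assume x: "x \<in> X"
      have "- int (M * n) \<le> \<lfloor>n * (x \<bullet> b')\<rfloor> \<and> \<lfloor>n * (x \<bullet> b')\<rfloor> \<le> int (M * n)" if "b' \<in> B" for b'
      proof -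
        have "\<bar>n * (x \<bullet> b')\<bar> \<le> M * n"
          using mult_left_mono[OF M[OF x that], of "real n"] by (simp add: abs_mult mult.commute)
        then show ?thesis
          by (simp add: le_floor_iff floor_le_iff abs_le_iff)
      qed
      then have "(\<lambda>b'\<in>?B. \<lfloor>n * (x \<bullet> b')\<rfloor>) \<in> K"
        by (simp add: K_def)
      moreover have "x \<in> cell (\<lambda>b'\<in>?B. \<lfloor>n * (x \<bullet> b')\<rfloor>)"
        using x by (simp add: cell_def)
      ultimately show "x \<in> \<Union>(cell ` K)"
        by blast
    qed
    moreover have "card (cell ` K) \<le> (3 * real M) ^ e * real n ^ e"
    proof -
      have "card (cell ` K) \<le> card K"
        by (rule card_image_le) fact
      also have "card K = (2 * M * n + 1) ^ e"
        using B card by (simp add: K_def card_PiE nat_add_distrib nat_mult_distrib mult.assoc)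
      also have "\<dots> \<le> (3 * M * n) ^ e"
      proof (rule power_mono)
        have "1 \<le> M * n"
          using n by (simp add: M_def)
        then show "2 * M * n + 1 \<le> 3 * M * n"
          by (simp add: mult.assoc)
      qed simp
      finally have "real (card (cell ` K)) \<le> real ((3 * M * n) ^ e)"
        by (rule of_nat_mono)
      then show ?thesis
        by (simp add: power_mult_distrib)
    qed
    moreover have "bounded (cell k) \<and> diameter (cell k) \<le> C * e / n" for k
    proof
      show "bounded (cell k)"
        by (rule bounded_subset[OF \<open>bounded X\<close>]) (auto simp: cell_def)
      show "diameter (cell k) \<le> C * e / n"
      proof (rule diameter_le)
        show "norm (x - y) \<le> C * e / n" if x: "x \<in> cell k" and y: "y \<in> cell k" for x y
        proof -
          have "\<bar>(x - y) \<bullet> b'\<bar> \<le> 1 / n" if "b' \<in> ?B" for b'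
          proof -
            have "\<lfloor>n * (x \<bullet> b')\<rfloor> = \<lfloor>n * (y \<bullet> b')\<rfloor>"
              using x y that by (simp add: cell_def)
            then have "\<bar>n * ((x - y) \<bullet> b')\<bar> \<le> 1"
              unfolding inner_diff_left right_diff_distrib by linarith
            then show ?thesis
              using n by (simp add: abs_mult field_simps)
          qed
          then have "(\<Sum>b'\<in>?B. \<bar>(x - y) \<bullet> b'\<bar>) \<le> (\<Sum>b'\<in>?B. 1 / n)"
            by (rule sum_mono)
          then have "(\<Sum>b'\<in>?B. \<bar>(x - y) \<bullet> b'\<bar>) \<le> e / n"
            by (simp add: card)
          then have "C * (\<Sum>b'\<in>?B. \<bar>(x - y) \<bullet> b'\<bar>) \<le> C * (e / n)"
            using C by (rule mult_left_mono)
          moreover have "norm (x - y) \<le> C * (\<Sum>b'\<in>?B. \<bar>(x - y) \<bullet> b'\<bar>)"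
            using x y by (intro graph) (auto simp: cell_def)
          ultimately show ?thesis
            by simp
        qed
      qed (use C in simp)
    qed
    ultimately show "\<exists>\<C>. finite \<C> \<and> X \<subseteq> \<Union>\<C> \<and> real (card \<C>) \<le> (3 * real M) ^ e * real n ^ e \<and>
        (\<forall>C'\<in>\<C>. bounded C' \<and> diameter C' \<le> C * e / n)"
      by (intro exI[of _ "cell ` K"]) auto
  qed (use C in auto)
qed

section \<open>Maxima of smooth families\<close>

lemma orthonormal_expansion:
  fixes B :: "'x::euclidean_space set"
  assumes "finite B" "pairwise orthogonal B" "\<And>b. b \<in> B \<Longrightarrow> norm b = 1" "v \<in> span B"
  shows "v = (\<Sum>b\<in>B. (v \<bullet> b) *\<^sub>R b)"
proof -
  obtain r where r: "v = (\<Sum>b\<in>B. r b *\<^sub>R b)"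
    using assms(1,4) by (auto simp: span_finite)
  have "v \<bullet> b = r b" if b: "b \<in> B" for b
  proof -
    have "v \<bullet> b = (\<Sum>b'\<in>B. if b' = b then r b else 0)"
      unfolding r inner_sum_left
    proof (rule sum.cong[OF refl])
      fix b' assume "b' \<in> B"
      then show "(r b' *\<^sub>R b') \<bullet> b = (if b' = b then r b else 0)"
        using assms(2,3) b by (auto simp: pairwise_def orthogonal_def norm_eq_1)
    qed
    then show ?thesis
      using b assms(1) by simp
  qed
  then show ?thesis
    using r by simp
qed

text \<open>An abstract Danskin setting. The Taylor bound is required only between points of
  \<open>X\<close>, so \<open>G u x\<close> acts as a gradient only along directions within
  \<open>X\<close>. The selection \<open>w\<close> of maximizers is arbitrary; no continuity of it
  is assumed.\<close>

locale smooth_maximum =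
  fixes F :: "'u::metric_space \<Rightarrow> 'x::euclidean_space \<Rightarrow> real" and G :: "'u \<Rightarrow> 'x \<Rightarrow> 'x"
    and U :: "'u set" and X :: "'x set" and w :: "'x \<Rightarrow> 'u" and K L :: real
  assumes compact_U: "compact U"
    and taylor: "u \<in> U \<Longrightarrow> x \<in> X \<Longrightarrow> y \<in> X \<Longrightarrow> \<bar>F u y - F u x - G u x \<bullet> (y - x)\<bar> \<le> K * (norm (y - x))\<^sup>2"
    and G_le: "u \<in> U \<Longrightarrow> x \<in> X \<Longrightarrow> norm (G u x) \<le> L"
    and K_nonneg: "0 \<le> K" and L_nonneg: "0 \<le> L"
    and cont_F: "x \<in> X \<Longrightarrow> continuous_on U (\<lambda>u. F u x)"
    and cont_G: "x \<in> X \<Longrightarrow> continuous_on U (\<lambda>u. G u x)"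
    and w_in: "x \<in> X \<Longrightarrow> w x \<in> U"
    and w_max: "u \<in> U \<Longrightarrow> x \<in> X \<Longrightarrow> F u x \<le> F (w x) x"
begin

definition maximizers :: "'x \<Rightarrow> 'u set" where
  "maximizers x = {u \<in> U. F u x = F (w x) x}"

definition kinks :: "'x \<Rightarrow> real \<Rightarrow> real \<Rightarrow> 'x set" where
  "kinks b p q = {x \<in> X. \<exists>u\<in>maximizers x. \<exists>u'\<in>maximizers x. G u x \<bullet> b \<le> p \<and> q \<le> G u' x \<bullet> b}"

text \<open>Gradients of maximizers are monotone up to \<open>K\<close>. Two kinks \<open>x\<close> and \<open>y = x + t b + v\<close> with
  \<open>t \<ge> 0\<close> and \<open>v \<bottom> b\<close>, compared through the larger slope at \<open>x\<close> and the smaller one at \<open>y\<close>, give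
  \<open>(q - p) t \<le> 2 L |v| + 2 K |y - x|\<^sup>2\<close>, so that kinks near a point form a Lipschitz graph over the
  complement of \<open>b\<close>.\<close>

lemma kinks_gap:
  assumes B: "finite B" "pairwise orthogonal B" "\<And>b. b \<in> B \<Longrightarrow> norm b = 1" "b \<in> B"
    and x: "x \<in> kinks b p q" and y: "y \<in> kinks b p q" and span: "y - x \<in> span B"
    and close: "norm (y - x) \<le> r" and r: "4 * K * r \<le> (q - p) / 2"
    and pq: "p < q" and t: "0 \<le> (y - x) \<bullet> b"
  shows "norm (y - x) \<le> (4 * L / (q - p) + 2) * (\<Sum>b'\<in>B - {b}. \<bar>(y - x) \<bullet> b'\<bar>)"
proof -
  let ?S = "\<Sum>b'\<in>B - {b}. \<bar>(y - x) \<bullet> b'\<bar>" and ?t = "(y - x) \<bullet> b"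
  define v where "v = (\<Sum>b'\<in>B - {b}. ((y - x) \<bullet> b') *\<^sub>R b')"
  have decomp: "y - x = ?t *\<^sub>R b + v"
    unfolding v_def using orthonormal_expansion[OF B(1-3) span] B by (simp add: sum.remove[of B b])
  have v: "norm v \<le> ?S"
    unfolding v_def by (rule sum_norm_le) (use B in simp)
  have norm_b: "norm b = 1"
    using B by simp
  have norm_le: "norm (y - x) \<le> ?t + ?S"
    using norm_triangle_ineq[of "?t *\<^sub>R b" v] decomp v t norm_b by simp
  obtain u where u: "u \<in> maximizers y" "G u y \<bullet> b \<le> p" and yX: "y \<in> X"
    using y by (auto simp: kinks_def)
  obtain u' where u': "u' \<in> maximizers x" "q \<le> G u' x \<bullet> b" and xX: "x \<in> X"
    using x by (auto simp: kinks_def)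
  have uU: "u \<in> U" "u' \<in> U"
    using u u' by (auto simp: maximizers_def)
  \<comment> \<open>\<open>u'\<close> is maximal at \<open>x\<close> and \<open>u\<close> at
    \<open>y\<close>. Added to the two Taylor bounds below, these inequalities cancel all values of
    \<open>F\<close> and leave a monotonicity estimate for the gradients.\<close>
  have "F u x \<le> F u' x" "F u' y \<le> F u y"
    using w_max uU xX yX u u' by (auto simp: maximizers_def)
  moreover have "F u x - F u y - G u y \<bullet> (x - y) \<ge> - (K * (norm (y - x))\<^sup>2)"
    using taylor[OF uU(1) yX xX] by (simp add: norm_minus_commute)
  moreover have "F u' y - F u' x - G u' x \<bullet> (y - x) \<ge> - (K * (norm (y - x))\<^sup>2)"
    using taylor[OF uU(2) xX yX] by simp
  ultimately have "(G u' x - G u y) \<bullet> (y - x) \<le> 2 * K * (norm (y - x))\<^sup>2"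
    by (simp add: inner_diff_left inner_diff_right)
  moreover have "(G u' x - G u y) \<bullet> (y - x) \<ge> (q - p) * ?t - 2 * L * ?S"
  proof -
    have "\<bar>(G u' x - G u y) \<bullet> v\<bar> \<le> norm (G u' x - G u y) * norm v"
      by (rule Cauchy_Schwarz_ineq2)
    also have "\<dots> \<le> (2 * L) * ?S"
      using G_le[OF uU(1) yX] G_le[OF uU(2) xX] L_nonneg v
      by (intro mult_mono norm_triangle_le_diff) auto
    finally have "- (2 * L * ?S) \<le> (G u' x - G u y) \<bullet> v"
      by linarith
    moreover have "(G u' x - G u y) \<bullet> (y - x) = ?t * ((G u' x - G u y) \<bullet> b) + (G u' x - G u y) \<bullet> v"
      by (subst decomp) (simp add: inner_add_right)
    moreover have "?t * (q - p) \<le> ?t * ((G u' x - G u y) \<bullet> b)"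
      using t u u' by (intro mult_left_mono) (auto simp: inner_diff_left)
    ultimately show ?thesis
      by (simp add: mult.commute)
  qed
  \<comment> \<open>Closeness makes one factor \<open>norm (y - x)\<close> small, so that this error
    costs only half of the term \<open>(q - p) * ?t\<close> in the lower bound.\<close>
  moreover have "2 * K * (norm (y - x))\<^sup>2 \<le> (q - p) / 2 * (?t + ?S)"
  proof -
    have "2 * K * norm (y - x) \<le> (q - p) / 2"
      using mult_left_mono[OF close, of "4 * K"] K_nonneg r
        mult_nonneg_nonneg[OF K_nonneg norm_ge_zero[of "y - x"]] by linarith
    then have "2 * K * norm (y - x) * norm (y - x) \<le> (q - p) / 2 * (?t + ?S)"
      using norm_le pq by (intro mult_mono) auto
    then show ?thesis
      by (simp add: power2_eq_square mult.assoc)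
  qed
  ultimately have "(q - p) / 2 * ?t \<le> (2 * L + (q - p) / 2) * ?S"
    by (simp add: field_simps)
  then have "?t \<le> (2 * L + (q - p) / 2) * ?S / ((q - p) / 2)"
    using pq by (simp add: pos_le_divide_eq mult.commute)
  also have "\<dots> = (4 * L / (q - p) + 1) * ?S"
    using pq by (simp add: field_simps)
  finally show ?thesis
    using norm_le by (simp add: algebra_simps)
qed

text \<open>The estimate \<open>kinks_gap\<close> is local: it gives the graph condition inside
  small balls, and countably many of them, centred at a dense set, cover all kinks.\<close>

lemma hausdorff_measure_kinks:
  assumes B: "finite B" "pairwise orthogonal B" "\<And>b. b \<in> B \<Longrightarrow> norm b = 1" "b \<in> B" "card B = d"
    and span: "\<And>x y. x \<in> X \<Longrightarrow> y \<in> X \<Longrightarrow> y - x \<in> span B" and pq: "p < q"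
  shows "hausdorff_measure d (kinks b p q) = 0"
proof -
  \<comment> \<open>Two points of a ball of radius \<open>r\<close> are at distance at most
    \<open>2 * r\<close>, which is the closeness passed to \<open>kinks_gap\<close>. The summand 1
    covers the case \<open>K = 0\<close>.\<close>
  define r where "r = (q - p) / (16 * (K + 1))"
  have r: "0 < r" "4 * K * (2 * r) \<le> (q - p) / 2"
    using pq K_nonneg by (auto simp: r_def field_simps)
  obtain D :: "'x set" where D: "countable D" "\<And>S. open S \<Longrightarrow> S \<noteq> {} \<Longrightarrow> \<exists>z\<in>D. z \<in> S"
    using countable_dense_exists[where 'a='x] by blast
  have "hausdorff_measure d (kinks b p q \<inter> ball z r) = 0" for z
  proof (rule hausdorff_measure_lipschitz_graph[OF B(1,5,4)])
    show "bounded (kinks b p q \<inter> ball z r)"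
      by (simp add: bounded_Int)
    show "0 \<le> 4 * L / (q - p) + 2"
      using pq L_nonneg by simp
    fix x y assume xy: "x \<in> kinks b p q \<inter> ball z r" "y \<in> kinks b p q \<inter> ball z r"
    then have X: "x \<in> X" "y \<in> X"
      by (auto simp: kinks_def)
    have "dist x y \<le> 2 * r"
      using xy dist_triangle[of x y z] by (simp add: dist_commute)
    then have close: "norm (y - x) \<le> 2 * r" "norm (x - y) \<le> 2 * r"
      by (simp_all add: dist_norm norm_minus_commute)
    have comm: "(\<Sum>b'\<in>B - {b}. \<bar>(y - x) \<bullet> b'\<bar>) = (\<Sum>b'\<in>B - {b}. \<bar>(x - y) \<bullet> b'\<bar>)"
      by (simp add: inner_diff_left abs_minus_commute)
    show "norm (y - x) \<le> (4 * L / (q - p) + 2) * (\<Sum>b'\<in>B - {b}. \<bar>(y - x) \<bullet> b'\<bar>)"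
    \<comment> \<open>\<open>kinks_gap\<close> wants a nonnegative coordinate along
      \<open>b\<close>; otherwise \<open>x\<close> and \<open>y\<close> are exchanged.\<close>
    proof (cases "0 \<le> (y - x) \<bullet> b")
      case True
      then show ?thesis
        using xy by (intro kinks_gap[OF B(1-4) _ _ span[OF X] close(1) r(2) pq]) auto
    next
      case False
      then have "0 \<le> (x - y) \<bullet> b"
        by (simp add: inner_diff_left)
      then have "norm (x - y) \<le> (4 * L / (q - p) + 2) * (\<Sum>b'\<in>B - {b}. \<bar>(x - y) \<bullet> b'\<bar>)"
        using xy by (intro kinks_gap[OF B(1-4) _ _ span[OF X(2,1)] close(2) r(2) pq]) auto
      then show ?thesis
        unfolding comm by (simp add: norm_minus_commute)
    qed
  qed
  then have "hausdorff_measure d (\<Union>z\<in>D. kinks b p q \<inter> ball z r) = 0"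
    using D(1) by (intro hausdorff_measure_UN_eq_0)
  moreover have "(\<Union>z\<in>D. kinks b p q \<inter> ball z r) = kinks b p q"
  proof -
    have "\<exists>z\<in>D. x \<in> ball z r" for x
      using D(2)[of "ball x r"] r(1) by (auto simp: dist_commute)
    then show ?thesis
      by blast
  qed
  ultimately show ?thesis
    by simp
qed

text \<open>Two different slopes would leave room for rationals \<open>p < q\<close> strictly
  between them and make \<open>x\<close> a kink.\<close>

lemma maximizer_gradient_eq:
  assumes B: "finite B" "pairwise orthogonal B" "\<And>b. b \<in> B \<Longrightarrow> norm b = 1"
    and x: "x \<in> X" and smooth: "\<And>b p q. b \<in> B \<Longrightarrow> p \<in> \<rat> \<Longrightarrow> q \<in> \<rat> \<Longrightarrow> p < q \<Longrightarrow> x \<notin> kinks b p q"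
    and u: "u \<in> maximizers x" "u' \<in> maximizers x" and b: "b \<in> B"
  shows "G u x \<bullet> b = G u' x \<bullet> b"
proof -
  have "G v x \<bullet> b \<ge> G v' x \<bullet> b" if v: "v \<in> maximizers x" "v' \<in> maximizers x" for v v'
  proof (rule ccontr)
    assume "\<not> G v x \<bullet> b \<ge> G v' x \<bullet> b"
    then obtain p where p: "p \<in> \<rat>" "G v x \<bullet> b < p" "p < G v' x \<bullet> b"
      using Rats_dense_in_real[of "G v x \<bullet> b" "G v' x \<bullet> b"] by force
    then obtain q where q: "q \<in> \<rat>" "p < q" "q < G v' x \<bullet> b"
      using Rats_dense_in_real by blast
    have "x \<in> kinks b p q"
      unfolding kinks_def using x v p(2) q(3) less_imp_le by blast
    with smooth[OF b p(1) q(1,2)] show False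
      by blast
  qed
  then show ?thesis
    using u by (meson order_antisym)
qed

text \<open>Although \<open>w\<close> may jump, every limit point of \<open>w (x + \<delta>)\<close>
  is a maximizer at \<open>x\<close>. By compactness, slopes staying away from \<open>g\<close>
  along a sequence would produce a maximizer at \<open>x\<close> whose slope is not
  \<open>g\<close>.\<close>

lemma maximizer_gradient_tendsto:
  assumes x: "x \<in> X" and unique: "\<And>u. u \<in> maximizers x \<Longrightarrow> G u x \<bullet> b = g"
  shows "((\<lambda>\<delta>. G (w (x + \<delta>)) x \<bullet> b) \<longlongrightarrow> g) (at 0 within {\<delta>. x + \<delta> \<in> X})"
proof (rule ccontr)
  assume "\<not> ?thesis"
  then obtain e where e: "0 < e" and far: "\<not> (\<exists>\<eta>>0. \<forall>\<delta>\<in>{\<delta>. x + \<delta> \<in> X}. 0 < dist \<delta> 0 \<and> dist \<delta> 0 < \<eta> \<longrightarrow>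
      dist (G (w (x + \<delta>)) x \<bullet> b) g < e)"
    unfolding Lim_within by blast
  have "\<exists>\<delta>. x + \<delta> \<in> X \<and> norm \<delta> < 1 / Suc n \<and> e \<le> \<bar>G (w (x + \<delta>)) x \<bullet> b - g\<bar>" for n
  proof (rule ccontr)
    assume near: "\<not> ?thesis"
    have "\<forall>\<delta>\<in>{\<delta>. x + \<delta> \<in> X}. 0 < dist \<delta> 0 \<and> dist \<delta> 0 < 1 / Suc n \<longrightarrow> dist (G (w (x + \<delta>)) x \<bullet> b) g < e"
    proof (intro ballI impI)
      fix \<delta> assume "\<delta> \<in> {\<delta>. x + \<delta> \<in> X}" "0 < dist \<delta> 0 \<and> dist \<delta> 0 < 1 / Suc n"
      with near have "\<not> e \<le> \<bar>G (w (x + \<delta>)) x \<bullet> b - g\<bar>"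
        by (simp only: dist_norm diff_zero mem_Collect_eq) blast
      then show "dist (G (w (x + \<delta>)) x \<bullet> b) g < e"
        by (simp add: dist_real_def)
    qed
    moreover have "0 < 1 / real (Suc n)"
      by simp
    ultimately show False
      using far by blast
  qed
  then have "\<exists>\<delta>. \<forall>n. x + \<delta> n \<in> X \<and> norm (\<delta> n) < 1 / Suc n \<and> e \<le> \<bar>G (w (x + \<delta> n)) x \<bullet> b - g\<bar>"
    by (intro choice allI)
  then obtain \<delta> where \<delta>: "x + \<delta> n \<in> X" "norm (\<delta> n) < 1 / Suc n" "e \<le> \<bar>G (w (x + \<delta> n)) x \<bullet> b - g\<bar>" for n
    by blast
  have "\<delta> \<longlonglongrightarrow> 0"
    using \<delta>(2) by (intro LIMSEQ_norm_0)
  obtain u s where u: "u \<in> U" and s: "strict_mono s" and lim: "(\<lambda>n. w (x + \<delta> (s n))) \<longlonglongrightarrow> u"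
    using compact_U[unfolded compact_def, rule_format, of "\<lambda>n. w (x + \<delta> n)"] \<delta>(1) w_in
    by (auto simp: comp_def)
  let ?w = "\<lambda>n. w (x + \<delta> (s n))"
  have \<delta>_s: "(\<lambda>n. norm (\<delta> (s n))) \<longlonglongrightarrow> 0"
    using LIMSEQ_subseq_LIMSEQ[OF \<open>\<delta> \<longlonglongrightarrow> 0\<close> s] by (simp add: comp_def tendsto_norm_zero)
  have F_lim: "(\<lambda>n. F (?w n) x) \<longlonglongrightarrow> F u x"
    by (rule continuous_on_tendsto_compose[OF cont_F[OF x] lim u]) (use \<delta>(1) w_in in auto)
  \<comment> \<open>This says that the limit \<open>u\<close> is maximal at \<open>x\<close>. The
    zeros stay unsimplified so that the bound has the shape of the sequence converging to
    it.\<close>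
  have "F (w x) x \<le> F u x + 2 * (L * 0 + K * 0\<^sup>2)"
  proof (rule LIMSEQ_le_const)
    show "(\<lambda>n. F (?w n) x + 2 * (L * norm (\<delta> (s n)) + K * (norm (\<delta> (s n)))\<^sup>2)) \<longlonglongrightarrow> F u x + 2 * (L * 0 + K * 0\<^sup>2)"
      by (intro tendsto_intros F_lim \<delta>_s)
    have "F (w x) x \<le> F (?w n) x + 2 * (L * norm (\<delta> (s n)) + K * (norm (\<delta> (s n)))\<^sup>2)" for n
    proof -
      define y where "y = x + \<delta> (s n)"
      define m where "m = L * norm (\<delta> (s n)) + K * (norm (\<delta> (s n)))\<^sup>2"
      have y: "y \<in> X"
        unfolding y_def by (rule \<delta>(1))
      have slope: "\<bar>F v y - F v x\<bar> \<le> m" if v: "v \<in> U" for v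
      proof -
        have "\<bar>G v x \<bullet> \<delta> (s n)\<bar> \<le> L * norm (\<delta> (s n))"
          using G_le[OF v x] by (intro order_trans[OF Cauchy_Schwarz_ineq2] mult_right_mono) auto
        then show ?thesis
          using taylor[OF v x y] by (simp add: y_def m_def)
      qed
      \<comment> \<open>At \<open>y\<close> the parameter \<open>w y\<close> is at least as good as
        \<open>w x\<close>; passing from \<open>x\<close> to \<open>y\<close> and back costs
        \<open>m\<close> each time.\<close>
      have "F (w x) x \<le> F (w y) x + 2 * m"
        using slope[OF w_in[OF x]] slope[OF w_in[OF y]] w_max[OF w_in[OF x] y] by linarith
      then show ?thesis
        by (simp add: y_def m_def)
    qed
    then show "\<exists>N. \<forall>n\<ge>N. F (w x) x \<le> F (?w n) x + 2 * (L * norm (\<delta> (s n)) + K * (norm (\<delta> (s n)))\<^sup>2)"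
      by blast
  qed
  then have "u \<in> maximizers x"
    using u x w_max by (force simp: maximizers_def)
  then have "G u x \<bullet> b = g"
    by (rule unique)
  moreover have "(\<lambda>n. G (?w n) x \<bullet> b) \<longlonglongrightarrow> G u x \<bullet> b"
    by (intro tendsto_inner tendsto_const continuous_on_tendsto_compose[OF cont_G[OF x] lim u])
      (use \<delta>(1) w_in in auto)
  ultimately have "(\<lambda>n. \<bar>G (?w n) x \<bullet> b - g\<bar>) \<longlonglongrightarrow> \<bar>g - g\<bar>"
    by (intro tendsto_intros) simp
  then have "e \<le> \<bar>g - g\<bar>"
    by (rule tendsto_lowerbound) (use \<delta>(3) in auto)
  with e show False
    by simp
qed

text \<open>In \<open>X\<close> outside \<open>N\<close>, all maximizers have the same slopes along
  an orthonormal basis of \<open>T\<close>. The increment of the maximum is squeezed between those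
  of the parameters \<open>w x\<close> and \<open>w (x + \<delta>)\<close>, both expanded at
  \<open>x\<close>.\<close>

theorem differentiable_off_null_set:
  assumes T: "subspace T" "\<And>x y. x \<in> X \<Longrightarrow> y \<in> X \<Longrightarrow> y - x \<in> T"
  obtains N where "hausdorff_measure (dim T) N = 0"
    "\<And>x. x \<in> X - N \<Longrightarrow> ((\<lambda>\<delta>. \<bar>F (w (x + \<delta>)) (x + \<delta>) - F (w x) x - G (w x) x \<bullet> \<delta>\<bar> / norm \<delta>) \<longlongrightarrow> 0)
      (at 0 within {\<delta>. x + \<delta> \<in> X})"
proof -
  obtain B where B: "pairwise orthogonal B" "\<And>b. b \<in> B \<Longrightarrow> norm b = 1"
      "independent B" "card B = dim T" "span B = T"
    using orthonormal_basis_subspace[OF T(1)] by metis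
  have fin: "finite B"
    using B(3) by (rule independent_imp_finite)
  define I where "I = {(p, q). p \<in> \<rat> \<and> q \<in> \<rat> \<and> p < (q::real)}"
  define N where "N = (\<Union>b\<in>B. \<Union>(p, q)\<in>I. kinks b p q)"
  have "countable I"
    by (rule countable_subset[of _ "\<rat> \<times> \<rat>"]) (auto simp: I_def countable_rat)
  then have "hausdorff_measure (dim T) N = 0"
    unfolding N_def
  proof (intro hausdorff_measure_UN_eq_0 countable_finite[OF fin])
    fix b i assume "b \<in> B" "i \<in> I"
    then show "hausdorff_measure (dim T) (case i of (p, q) \<Rightarrow> kinks b p q) = 0"
      using B(4,5) T(2) by (auto simp: I_def intro!: hausdorff_measure_kinks[OF fin B(1,2)])
  qed
  moreover have "((\<lambda>\<delta>. \<bar>F (w (x + \<delta>)) (x + \<delta>) - F (w x) x - G (w x) x \<bullet> \<delta>\<bar> / norm \<delta>) \<longlongrightarrow> 0)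
      (at 0 within {\<delta>. x + \<delta> \<in> X})" if "x \<in> X - N" for x
  proof -
    from that have x: "x \<in> X" and smooth: "\<And>b p q. b \<in> B \<Longrightarrow> p \<in> \<rat> \<Longrightarrow> q \<in> \<rat> \<Longrightarrow> p < q \<Longrightarrow> x \<notin> kinks b p q"
      by (auto simp: N_def I_def)
    have wx: "w x \<in> maximizers x"
      using x w_in by (simp add: maximizers_def)
    let ?g = "G (w x) x"
    \<comment> \<open>The bound for the quotient: the slope errors of the moving maximizer in the
      basis directions, plus the Taylor remainder divided by \<open>norm \<delta>\<close>.\<close>
    let ?\<psi> = "\<lambda>\<delta>. (\<Sum>b\<in>B. \<bar>G (w (x + \<delta>)) x \<bullet> b - ?g \<bullet> b\<bar>) + K * norm \<delta>"
    have "((\<lambda>\<delta>. \<bar>G (w (x + \<delta>)) x \<bullet> b - ?g \<bullet> b\<bar>) \<longlongrightarrow> \<bar>?g \<bullet> b - ?g \<bullet> b\<bar>) (at 0 within {\<delta>. x + \<delta> \<in> X})"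
      if "b \<in> B" for b
      by (intro tendsto_intros maximizer_gradient_tendsto[OF x] maximizer_gradient_eq[OF fin B(1,2) x smooth _ wx that])
    then have "(?\<psi> \<longlongrightarrow> (\<Sum>b\<in>B. \<bar>?g \<bullet> b - ?g \<bullet> b\<bar>) + K * norm (0::'x)) (at 0 within {\<delta>. x + \<delta> \<in> X})"
      by (intro tendsto_add tendsto_sum tendsto_mult tendsto_const tendsto_norm tendsto_ident_at)
    then have \<psi>: "(?\<psi> \<longlongrightarrow> 0) (at 0 within {\<delta>. x + \<delta> \<in> X})"
      by simp
    have "\<bar>F (w (x + \<delta>)) (x + \<delta>) - F (w x) x - ?g \<bullet> \<delta>\<bar> / norm \<delta> \<le> ?\<psi> \<delta>" if \<delta>: "x + \<delta> \<in> X" "\<delta> \<noteq> 0" for \<delta>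
    proof -
      let ?y = "x + \<delta>"
      let ?h = "G (w ?y) x"
      \<comment> \<open>The first inequality bounds the increment of the maximum from below, the
        second from above.\<close>
      have "F (w x) ?y \<le> F (w ?y) ?y" "F (w ?y) x \<le> F (w x) x"
        using w_max w_in x \<delta> by auto
      moreover have "\<bar>F (w x) ?y - F (w x) x - ?g \<bullet> \<delta>\<bar> \<le> K * (norm \<delta>)\<^sup>2"
        using taylor[OF w_in[OF x] x \<delta>(1)] by simp
      moreover have "\<bar>F (w ?y) ?y - F (w ?y) x - ?h \<bullet> \<delta>\<bar> \<le> K * (norm \<delta>)\<^sup>2"
        using taylor[OF w_in[OF \<delta>(1)] x \<delta>(1)] by simp
      ultimately have "\<bar>F (w ?y) ?y - F (w x) x - ?g \<bullet> \<delta>\<bar> \<le> \<bar>(?h - ?g) \<bullet> \<delta>\<bar> + K * (norm \<delta>)\<^sup>2"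
        unfolding inner_diff_left by linarith
      moreover have "\<bar>(?h - ?g) \<bullet> \<delta>\<bar> \<le> (\<Sum>b\<in>B. \<bar>?h \<bullet> b - ?g \<bullet> b\<bar>) * norm \<delta>"
      proof -
        have "\<delta> \<in> span B"
          using T(2)[OF x \<delta>(1)] B(5) by simp
        have "(?h - ?g) \<bullet> \<delta> = (\<Sum>b\<in>B. (\<delta> \<bullet> b) * ((?h - ?g) \<bullet> b))"
          by (subst orthonormal_expansion[OF fin B(1,2) \<open>\<delta> \<in> span B\<close>]) (simp_all add: inner_sum_right)
        also have "\<bar>\<dots>\<bar> \<le> (\<Sum>b\<in>B. \<bar>?h \<bullet> b - ?g \<bullet> b\<bar> * norm \<delta>)"
        proof (rule order_trans[OF sum_abs sum_mono])
          fix b assume "b \<in> B"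
          then have "\<bar>\<delta> \<bullet> b\<bar> \<le> norm \<delta>"
            using Cauchy_Schwarz_ineq2[of \<delta> b] B(2) by simp
          then show "\<bar>\<delta> \<bullet> b * ((?h - ?g) \<bullet> b)\<bar> \<le> \<bar>?h \<bullet> b - ?g \<bullet> b\<bar> * norm \<delta>"
            by (simp add: abs_mult inner_diff_left mult.commute mult_right_mono)
        qed
        finally show ?thesis
          by (simp add: sum_distrib_right)
      qed
      ultimately have "\<bar>F (w ?y) ?y - F (w x) x - ?g \<bullet> \<delta>\<bar> \<le> ?\<psi> \<delta> * norm \<delta>"
        by (simp add: algebra_simps power2_eq_square)
      then show ?thesis
        using \<delta>(2) by (simp add: pos_divide_le_eq)
    qed
    then have "\<forall>\<^sub>F \<delta> in at 0 within {\<delta>. x + \<delta> \<in> X}. \<bar>F (w (x + \<delta>)) (x + \<delta>) - F (w x) x - ?g \<bullet> \<delta>\<bar> / norm \<delta> \<le> ?\<psi> \<delta>"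
      by (auto simp: eventually_at intro!: exI[of _ 1])
    with \<psi> show ?thesis
      by (intro tendsto_sandwich[OF _ _ tendsto_const \<psi>]) (auto intro: always_eventually)
  qed
  ultimately show thesis
    by (rule that)
qed

end

section \<open>State-action marginals and Bellman equations\<close>

text \<open>This is the law of the pair at time \<open>t\<close>, by
  \<open>distr_traj_component\<close>. Values and occupancies are discounted sums over single times
  and depend on the trajectory measure only through these marginals.\<close>

definition pair_law ::
  "real ^ 's ^ 'a ^ 's \<Rightarrow> real ^ 'a ^ 's \<Rightarrow> ('s \<times> 'a) pmf \<Rightarrow> nat \<Rightarrow> ('s \<times> 'a) pmf" where
  "pair_law P \<pi> \<mu> t = ((\<lambda>\<nu>. bind_pmf \<nu> (step_pmf P \<pi>)) ^^ t) \<mu>"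

lemma pair_law_Suc: "pair_law P \<pi> \<mu> (Suc t) = bind_pmf (pair_law P \<pi> \<mu> t) (step_pmf P \<pi>)"
  by (simp add: pair_law_def)

lemma pair_law_Suc_shift: "pair_law P \<pi> \<mu> (Suc t) = pair_law P \<pi> (bind_pmf \<mu> (step_pmf P \<pi>)) t"
  by (simp add: pair_law_def funpow_Suc_right del: funpow.simps)

lemma pair_law_bind_pmf: "pair_law P \<pi> (bind_pmf \<nu> h) t = bind_pmf \<nu> (\<lambda>y. pair_law P \<pi> (h y) t)"
  by (induction t) (simp_all add: pair_law_Suc bind_assoc_pmf, simp add: pair_law_def)

lemma sets_traj: "sets (traj P \<pi> \<mu>) = sets (PiM UNIV (\<lambda>_::nat. count_space (UNIV :: ('s::finite \<times> 'a::finite) set)))"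
  for P :: "real ^ 's ^ 'a ^ 's"
proof -
  interpret IT: Ionescu_Tulcea "traj_step P \<pi> \<mu>" "\<lambda>_. count_space UNIV"
    by (rule Ionescu_Tulcea_traj_step)
  show ?thesis
    by (simp add: traj_def)
qed

lemma measurable_traj_component [measurable]:
  "(\<lambda>\<omega>. \<omega> t) \<in> traj P \<pi> \<mu> \<rightarrow>\<^sub>M count_space (UNIV :: ('s::finite \<times> 'a::finite) set)"
  for P :: "real ^ 's ^ 'a ^ 's"
  using measurable_component_singleton[of t UNIV "\<lambda>_. count_space (UNIV :: ('s \<times> 'a) set)"]
  by (simp cong: measurable_cong_sets[OF sets_traj refl])

text \<open>An event at time \<open>t\<close> is a cylinder over the first \<open>t + 1\<close>
  coordinates, so the limit measure reduces to a finite Ionescu-Tulcea measure. There the marginals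
  follow by induction, as \<open>traj_step\<close> reads only the latest pair.\<close>

lemma distr_traj_component:
  fixes P :: "real ^ 's::finite ^ 'a::finite ^ 's"
  shows "distr (traj P \<pi> \<mu>) (count_space UNIV) (\<lambda>\<omega>. \<omega> t) = measure_pmf (pair_law P \<pi> \<mu> t)"
proof -
  interpret IT: Ionescu_Tulcea "traj_step P \<pi> \<mu>" "\<lambda>_. count_space UNIV"
    by (rule Ionescu_Tulcea_traj_step)
  let ?M = "\<lambda>J. PiM J (\<lambda>_. count_space (UNIV :: ('s \<times> 'a) set))"
  \<comment> \<open>\<open>?C n\<close> is the law of the coordinates below \<open>n\<close>,
    started from the empty history; the pair at time \<open>n\<close> first appears in
    \<open>?C (Suc n)\<close>.\<close>
  let ?C = "\<lambda>n. IT.C 0 n (\<lambda>_. undefined)"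
  have traj_step_Suc: "traj_step P \<pi> \<mu> (Suc n) \<omega> = measure_pmf (step_pmf P \<pi> (\<omega> n))" for n \<omega>
    by (simp add: traj_step_def)
  have space0: "(\<lambda>_. undefined) \<in> space (?M {0..<0})"
    by (simp add: space_PiM PiE_def extensional_def)
  have integral_Suc: "(\<integral>\<^sup>+\<omega>. g (\<omega> n) \<partial>?C (Suc n)) = (\<integral>\<^sup>+\<omega>. (\<integral>\<^sup>+x. g x \<partial>traj_step P \<pi> \<mu> n \<omega>) \<partial>?C n)"
    for n and g :: "'s \<times> 'a \<Rightarrow> ennreal"
  proof -
    have comp: "(\<lambda>\<omega>. g (\<omega> n)) \<in> borel_measurable (?M {0..<Suc n})"
      by (rule measurable_compose[of "\<lambda>\<omega>. \<omega> n", OF measurable_component_singleton]) auto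
    have "(\<integral>\<^sup>+\<omega>. g (\<omega> n) \<partial>?C (Suc n)) = (\<integral>\<^sup>+\<omega>. (\<integral>\<^sup>+\<omega>'. g (\<omega>' n) \<partial>IT.eP n \<omega>) \<partial>?C n)"
      using comp IT.measurable_eP[of n]
      by (simp, subst nn_integral_bind[where B="?M {0..<Suc n}"])
        (auto cong: measurable_cong_sets[OF IT.sets_C[OF space0, simplified] refl])
    also have "\<dots> = (\<integral>\<^sup>+\<omega>. (\<integral>\<^sup>+x. g x \<partial>traj_step P \<pi> \<mu> n \<omega>) \<partial>?C n)"
    proof (rule nn_integral_cong)
      fix \<omega> assume "\<omega> \<in> space (?C n)"
      then have "\<omega> \<in> space (?M {0..<n})"
        using IT.space_C[OF space0, of n] by simp
      from IT.nn_integral_eP[OF this comp]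
      show "(\<integral>\<^sup>+\<omega>'. g (\<omega>' n) \<partial>IT.eP n \<omega>) = (\<integral>\<^sup>+x. g x \<partial>traj_step P \<pi> \<mu> n \<omega>)"
        by simp
    qed
    finally show ?thesis .
  qed
  have marginal: "(\<integral>\<^sup>+\<omega>. g (\<omega> n) \<partial>?C (Suc n)) = (\<integral>\<^sup>+x. g x \<partial>pair_law P \<pi> \<mu> n)"
    for n and g :: "'s \<times> 'a \<Rightarrow> ennreal"
  proof (induction n arbitrary: g)
    case 0
    show ?case
      unfolding integral_Suc
      by (simp add: pair_law_def traj_step_def nn_integral_return[OF space0, simplified])
  next
    case (Suc n)
    \<comment> \<open>The induction hypothesis is used for the one-step average of \<open>g\<close>,
      a function of the pair at time \<open>n\<close>.\<close>
    show ?case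
      using Suc[of "\<lambda>x. \<integral>\<^sup>+y. g y \<partial>step_pmf P \<pi> x"]
      unfolding integral_Suc[of _ g] by (simp add: traj_step_Suc pair_law_Suc nn_integral_bind_pmf del: IT.C.simps)
  qed
  show ?thesis
  proof (rule measure_eqI)
    fix A :: "('s \<times> 'a) set"
    let ?X = "{\<omega> \<in> space (?M {0..<Suc t}). \<omega> t \<in> A}"
    have X: "?X \<in> sets (?M {0..<Suc t})"
      by measurable
    have emb: "prod_emb UNIV (\<lambda>_. count_space UNIV) {0..<Suc t} ?X = {\<omega>. \<omega> t \<in> A}"
      by (auto simp: prod_emb_def space_PiM)
    have CI: "emeasure (IT.CI {0..<Suc t}) ?X = emeasure (?C (Suc t)) ?X"
    proof -
      have "prod_emb {0..<Suc t} (\<lambda>_. count_space UNIV) {0..<Suc t} ?X = ?X"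
        using X by (intro prod_emb_id) (auto simp: space_PiM)
      then show ?thesis
        using IT.emeasure_CI[OF order_refl X] by simp
    qed
    have "emeasure (distr (traj P \<pi> \<mu>) (count_space UNIV) (\<lambda>\<omega>. \<omega> t)) A = emeasure (traj P \<pi> \<mu>) {\<omega>. \<omega> t \<in> A}"
      by (subst emeasure_distr[OF measurable_traj_component])
        (auto simp: sets_eq_imp_space_eq[OF sets_traj] space_PiM intro!: arg_cong2[where f=emeasure])
    also have "\<dots> = emeasure (?C (Suc t)) ?X"
      using IT.lim[OF _ X] CI by (simp add: traj_def emb)
    also have "\<dots> = (\<integral>\<^sup>+\<omega>. indicator ?X \<omega> \<partial>?C (Suc t))"
      using X IT.sets_C[OF space0, of "Suc t"]
      by (subst nn_integral_indicator) (simp_all del: IT.C.simps)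
    also have "\<dots> = (\<integral>\<^sup>+\<omega>. indicator A (\<omega> t) \<partial>?C (Suc t))"
      by (rule nn_integral_cong) (auto simp: indicator_def IT.space_C[OF space0, of "Suc t"] simp del: IT.C.simps)
    also have "\<dots> = emeasure (pair_law P \<pi> \<mu> t) A"
      by (simp add: marginal del: IT.C.simps)
    finally show "emeasure (distr (traj P \<pi> \<mu>) (count_space UNIV) (\<lambda>\<omega>. \<omega> t)) A = emeasure (pair_law P \<pi> \<mu> t) A" .
  qed simp
qed

lemma prob_space_traj: "prob_space (traj P \<pi> \<mu>)"
  for P :: "real ^ 's::finite ^ 'a::finite ^ 's"
  by (rule prob_space_distrD[OF measurable_traj_component[where t=0]])
    (simp add: distr_traj_component measure_pmf.prob_space_axioms)

section \<open>Discounted costs and Bellman equations for a fixed kernel\<close>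

definition cost_bound :: "('s::finite \<Rightarrow> 'a::finite \<Rightarrow> real) \<Rightarrow> real" where
  "cost_bound c = (\<Sum>s\<in>UNIV. \<Sum>a\<in>UNIV. \<bar>c s a\<bar>)"

lemma cost_bound_nonneg: "0 \<le> cost_bound c"
  by (simp add: cost_bound_def sum_nonneg)

lemma abs_le_cost_bound: "\<bar>c s a\<bar> \<le> cost_bound c"
proof -
  have "\<bar>c s a\<bar> \<le> (\<Sum>a\<in>UNIV. \<bar>c s a\<bar>)"
    by (rule member_le_sum) auto
  also have "\<dots> \<le> cost_bound c"
    unfolding cost_bound_def by (rule member_le_sum[where f="\<lambda>s. \<Sum>a\<in>UNIV. \<bar>c s a\<bar>"]) (auto simp: sum_nonneg)
  finally show ?thesis .
qed

text \<open>A free law of the first pair covers \<open>V_fun\<close> and \<open>Q_fun\<close> at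
  once and makes linearity in that law available, see \<open>total_cost_bind_pmf\<close>.\<close>

definition total_cost ::
  "('s \<Rightarrow> 'a \<Rightarrow> real) \<Rightarrow> real \<Rightarrow> real ^ 's ^ 'a ^ 's \<Rightarrow> real ^ 'a ^ 's \<Rightarrow> ('s \<times> 'a) pmf \<Rightarrow> real" where
  "total_cost c \<gamma> P \<pi> \<mu> = (\<Sum>t. \<gamma> ^ t * measure_pmf.expectation (pair_law P \<pi> \<mu> t) (\<lambda>x. c (fst x) (snd x)))"

lemma abs_expectation_le:
  fixes p :: "'x::finite pmf" and g :: "'x \<Rightarrow> real"
  assumes "\<And>x. \<bar>g x\<bar> \<le> B"
  shows "\<bar>measure_pmf.expectation p g\<bar> \<le> B"
proof -
  have "\<bar>measure_pmf.expectation p g\<bar> \<le> measure_pmf.expectation p (\<lambda>x. \<bar>g x\<bar>)"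
    by (rule integral_abs_bound)
  also have "\<dots> \<le> measure_pmf.expectation p (\<lambda>_. B)"
    using assms by (intro integral_mono integrable_measure_pmf_finite) auto
  finally show ?thesis
    by simp
qed

lemma abs_expectation_le_cost_bound:
  "\<bar>measure_pmf.expectation p (\<lambda>x. c (fst x) (snd x))\<bar> \<le> cost_bound c"
  for p :: "('s::finite \<times> 'a::finite) pmf"
  by (rule abs_expectation_le) (rule abs_le_cost_bound)

context
  fixes c :: "'s::finite \<Rightarrow> 'a::finite \<Rightarrow> real" and \<gamma> :: real
  assumes discount: "0 < \<gamma>" "\<gamma> < 1"
begin

lemma summable_total_cost:
  "summable (\<lambda>t. \<gamma> ^ t * measure_pmf.expectation (pair_law P \<pi> \<mu> t) (\<lambda>x. c (fst x) (snd x)))"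
proof (rule summable_comparison_test')
  show "summable (\<lambda>t. \<gamma> ^ t * cost_bound c)"
    using discount by (intro summable_mult2 summable_geometric) auto
  show "norm (\<gamma> ^ t * measure_pmf.expectation (pair_law P \<pi> \<mu> t) (\<lambda>x. c (fst x) (snd x))) \<le> \<gamma> ^ t * cost_bound c" for t
    using discount by (auto simp: abs_mult abs_expectation_le_cost_bound intro!: mult_left_mono)
qed

text \<open>A geometric series dominates the summands, so sum and integral may be exchanged.\<close>

lemma integral_discounted_cost:
  "(\<integral>\<omega>. discounted_cost c \<gamma> \<omega> \<partial>traj P \<pi> \<mu>) = total_cost c \<gamma> P \<pi> \<mu>"
proof -
  interpret prob_space "traj P \<pi> \<mu>"
    by (rule prob_space_traj)
  have meas: "(\<lambda>\<omega>. h (\<omega> t)) \<in> borel_measurable (traj P \<pi> \<mu>)" for t and h :: "'s \<times> 'a \<Rightarrow> real"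
    by (rule measurable_compose[OF measurable_traj_component]) simp
  let ?f = "\<lambda>t \<omega>. \<gamma> ^ t * c (fst (\<omega> t)) (snd (\<omega> t))"
  have bound: "norm (?f t \<omega>) \<le> \<gamma> ^ t * cost_bound c" for t \<omega>
    using discount by (auto simp: abs_mult abs_le_cost_bound intro!: mult_left_mono)
  have summable: "summable (\<lambda>t. \<gamma> ^ t * cost_bound c)"
    using discount by (intro summable_mult2 summable_geometric) auto
  have int: "integrable (traj P \<pi> \<mu>) (?f t)" for t
    using bound meas[of "\<lambda>x. \<gamma> ^ t * c (fst x) (snd x)" t]
    by (intro integrable_const_bound[where B="\<gamma> ^ t * cost_bound c"]) auto
  have "(\<integral>\<omega>. discounted_cost c \<gamma> \<omega> \<partial>traj P \<pi> \<mu>) = (\<Sum>t. \<integral>\<omega>. ?f t \<omega> \<partial>traj P \<pi> \<mu>)"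
    unfolding discounted_cost_def
  proof (rule integral_suminf[OF int])
    show "AE \<omega> in traj P \<pi> \<mu>. summable (\<lambda>t. norm (?f t \<omega>))"
      using bound by (intro AE_I2 summable_comparison_test'[OF summable]) auto
    have "(\<integral>\<omega>. norm (?f t \<omega>) \<partial>traj P \<pi> \<mu>) \<le> \<gamma> ^ t * cost_bound c" for t
      using integral_mono[OF integrable_norm[OF int[of t]] integrable_const[of "\<gamma> ^ t * cost_bound c"]] bound prob_space
      by simp
    then show "summable (\<lambda>t. \<integral>\<omega>. norm (?f t \<omega>) \<partial>traj P \<pi> \<mu>)"
      by (intro summable_comparison_test'[OF summable]) (auto simp: integral_nonneg_AE)
  qed
  also have "\<dots> = total_cost c \<gamma> P \<pi> \<mu>"
    unfolding total_cost_def by (simp add: distr_traj_component[symmetric] integral_distr)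
  finally show ?thesis .
qed

lemma total_cost_bind_pmf:
  "total_cost c \<gamma> P \<pi> (bind_pmf \<nu> h) = (\<Sum>y\<in>UNIV. pmf \<nu> y * total_cost c \<gamma> P \<pi> (h y))"
  for \<nu> :: "'y::finite pmf"
proof -
  have "total_cost c \<gamma> P \<pi> (bind_pmf \<nu> h) = (\<Sum>t. \<Sum>y\<in>UNIV. pmf \<nu> y *
      (\<gamma> ^ t * measure_pmf.expectation (pair_law P \<pi> (h y) t) (\<lambda>x. c (fst x) (snd x))))"
    unfolding total_cost_def pair_law_bind_pmf
    by (subst pmf_expectation_bind[of UNIV]) (auto simp: sum_distrib_left mult_ac)
  also have "\<dots> = (\<Sum>y\<in>UNIV. pmf \<nu> y * total_cost c \<gamma> P \<pi> (h y))"
    unfolding total_cost_def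
    by (subst suminf_sum) (auto simp: suminf_mult summable_total_cost intro!: summable_mult)
  finally show ?thesis .
qed

text \<open>Time 0 contributes \<open>c s a\<close>; what follows is the same process started from
  the law of the next pair, discounted once.\<close>

lemma total_cost_return_pmf:
  "total_cost c \<gamma> P \<pi> (return_pmf (s, a)) = c s a + \<gamma> * total_cost c \<gamma> P \<pi> (step_pmf P \<pi> (s, a))"
proof -
  have "total_cost c \<gamma> P \<pi> (return_pmf (s, a)) =
      (\<Sum>t. \<gamma> ^ Suc t * measure_pmf.expectation (pair_law P \<pi> (return_pmf (s, a)) (Suc t)) (\<lambda>x. c (fst x) (snd x)))
      + measure_pmf.expectation (pair_law P \<pi> (return_pmf (s, a)) 0) (\<lambda>x. c (fst x) (snd x))"
    unfolding total_cost_def by (subst suminf_split_head[OF summable_total_cost]) simp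
  also have "\<dots> = \<gamma> * total_cost c \<gamma> P \<pi> (step_pmf P \<pi> (s, a)) + c s a"
    unfolding total_cost_def pair_law_Suc_shift
    by (subst suminf_mult[OF summable_total_cost, symmetric])
      (simp_all add: bind_return_pmf mult.assoc, simp add: pair_law_def)
  finally show ?thesis
    by simp
qed

lemma V_fun_eq_Q_fun:
  assumes "\<pi> \<in> policies"
  shows "V_fun c \<gamma> P \<pi> s = (\<Sum>a\<in>UNIV. \<pi> $ s $ a * Q_fun c \<gamma> P \<pi> s a)"
  using assms
  by (simp add: V_fun_def Q_fun_def integral_discounted_cost map_pmf_def total_cost_bind_pmf policies_def pmf_vec_pmf)

lemma Q_fun_eq_V_fun:
  assumes "P \<in> kernels"
  shows "Q_fun c \<gamma> P \<pi> s a = c s a + \<gamma> * (\<Sum>s'\<in>UNIV. P $ s $ a $ s' * V_fun c \<gamma> P \<pi> s')"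
  using assms
  by (simp add: V_fun_def Q_fun_def integral_discounted_cost total_cost_return_pmf step_pmf_def
      total_cost_bind_pmf kernels_def pmf_vec_pmf)

lemma abs_total_cost_le: "\<bar>total_cost c \<gamma> P \<pi> \<mu>\<bar> \<le> cost_bound c / (1 - \<gamma>)"
proof -
  have "norm (total_cost c \<gamma> P \<pi> \<mu>) \<le> (\<Sum>t. \<gamma> ^ t * cost_bound c)"
    unfolding total_cost_def
    using discount by (intro norm_suminf_le summable_mult2 summable_geometric)
      (auto simp: abs_mult abs_expectation_le_cost_bound intro!: mult_left_mono)
  also have "\<dots> = cost_bound c / (1 - \<gamma>)"
    using discount by (subst suminf_mult2[symmetric]) (auto simp: suminf_geometric summable_geometric)
  finally show ?thesis
    by simp
qed

lemma abs_V_fun_le: "\<bar>V_fun c \<gamma> P \<pi> s\<bar> \<le> cost_bound c / (1 - \<gamma>)"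
  by (simp add: V_fun_def integral_discounted_cost abs_total_cost_le)

lemma abs_Q_fun_le: "\<bar>Q_fun c \<gamma> P \<pi> s a\<bar> \<le> cost_bound c / (1 - \<gamma>)"
  by (simp add: Q_fun_def integral_discounted_cost abs_total_cost_le)

end

text \<open>Visits to \<open>s'\<close> are counted by a cost of 1 in that state. Thus bounds,
  Bellman equations and Lipschitz estimates for values carry over to occupancies.\<close>

lemma occupancy_eq_V_fun:
  assumes "0 < \<gamma>" "\<gamma> < 1"
  shows "occupancy \<gamma> P \<pi> s s' = (1 - \<gamma>) * V_fun (\<lambda>t _. if t = s' then 1 else 0) \<gamma> P \<pi> s"
proof -
  have "measure (traj_from P \<pi> s) {\<omega>. fst (\<omega> t) = s'} =
    measure_pmf.expectation (pair_law P \<pi> (map_pmf (Pair s) (vec_pmf (\<pi> $ s))) t) (\<lambda>x. if fst x = s' then 1 else 0)" for t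
  proof -
    have "measure (traj_from P \<pi> s) {\<omega>. fst (\<omega> t) = s'} =
        measure (distr (traj_from P \<pi> s) (count_space UNIV) (\<lambda>\<omega>. \<omega> t)) {x. fst x = s'}"
      by (subst measure_distr)
        (auto simp: sets_eq_imp_space_eq[OF sets_traj] space_PiM intro!: arg_cong2[where f=measure])
    also have "\<dots> = measure_pmf.expectation (pair_law P \<pi> (map_pmf (Pair s) (vec_pmf (\<pi> $ s))) t) (indicator {x. fst x = s'})"
      by (simp add: distr_traj_component)
    also have "(indicator {x. fst x = s'} :: _ \<Rightarrow> real) = (\<lambda>x. if fst x = s' then 1 else 0)"
      by auto
    finally show ?thesis .
  qed
  then show ?thesis
    unfolding occupancy_def V_fun_def integral_discounted_cost[OF assms] total_cost_def by simp
qed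

section \<open>Maximum principle, performance difference, Lipschitz estimates and the robust Bellman
  equation\<close>

lemma policies_nonneg: "\<pi> \<in> policies \<Longrightarrow> 0 \<le> \<pi> $ s $ a"
  and policies_sum: "\<pi> \<in> policies \<Longrightarrow> (\<Sum>a\<in>UNIV. \<pi> $ s $ a) = 1"
  by (auto simp: policies_def prob_simplex_def)

lemma kernels_nonneg: "P \<in> kernels \<Longrightarrow> 0 \<le> P $ s $ a $ s'"
  and kernels_sum: "P \<in> kernels \<Longrightarrow> (\<Sum>s'\<in>UNIV. P $ s $ a $ s') = 1"
  by (auto simp: kernels_def prob_simplex_def)

definition state_kernel :: "real ^ 's ^ 'a ^ 's \<Rightarrow> real ^ 'a ^ 's \<Rightarrow> 's \<Rightarrow> 's \<Rightarrow> real" where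
  "state_kernel P \<pi> s s' = (\<Sum>a\<in>UNIV. \<pi> $ s $ a * P $ s $ a $ s')"

lemma sum_state_kernel_mult:
  "(\<Sum>s'\<in>UNIV. state_kernel P \<pi> s s' * W s') = (\<Sum>a\<in>UNIV. \<pi> $ s $ a * (\<Sum>s'\<in>UNIV. P $ s $ a $ s' * W s'))"
  unfolding state_kernel_def sum_distrib_right sum_distrib_left
  by (subst sum.swap) (simp add: mult.assoc)

text \<open>At a state where \<open>D\<close> attains its maximum \<open>M\<close>, its average
  under the stochastic state kernel is at most \<open>M\<close>, whence
  \<open>M \<le> e + \<gamma> * M\<close>. This replaces inverting the Bellman operator and provides
  uniqueness, stability and comparison below.\<close>

lemma discounted_maximum_principle:
  fixes D :: "'s::finite \<Rightarrow> real"
  assumes P: "P \<in> kernels" and \<pi>: "\<pi> \<in> policies" and discount: "0 < \<gamma>" "\<gamma> < 1"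
    and D: "\<And>s. D s \<le> e + \<gamma> * (\<Sum>s'\<in>UNIV. state_kernel P \<pi> s s' * D s')"
  shows "D s \<le> e / (1 - \<gamma>)"
proof -
  define M where "M = Max (range D)"
  have D_le: "D s \<le> M" for s
    by (simp add: M_def)
  have "M \<in> range D"
    unfolding M_def by (rule Max_in) auto
  then obtain m where m: "D m = M"
    by auto
  have "(\<Sum>s'\<in>UNIV. state_kernel P \<pi> m s' * D s') \<le> (\<Sum>s'\<in>UNIV. state_kernel P \<pi> m s' * M)"
    using D_le P \<pi>
    by (intro sum_mono mult_left_mono) (auto simp: state_kernel_def policies_nonneg kernels_nonneg intro!: sum_nonneg)
  also have "\<dots> = M"
    unfolding sum_state_kernel_mult
    unfolding sum_distrib_right[symmetric] kernels_sum[OF P] policies_sum[OF \<pi>] by simp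
  finally have "M \<le> e + \<gamma> * M"
    using D[of m] m discount by (smt (verit) mult_left_mono)
  then have "M \<le> e / (1 - \<gamma>)"
    using discount by (simp add: field_simps)
  with D_le show ?thesis
    using order_trans by blast
qed

lemma discounted_maximum_principle_abs:
  fixes D :: "'s::finite \<Rightarrow> real"
  assumes P: "P \<in> kernels" and \<pi>: "\<pi> \<in> policies" and discount: "0 < \<gamma>" "\<gamma> < 1"
    and D: "\<And>s. \<bar>D s - \<gamma> * (\<Sum>s'\<in>UNIV. state_kernel P \<pi> s s' * D s')\<bar> \<le> e"
  shows "\<bar>D s\<bar> \<le> e / (1 - \<gamma>)"
proof -
  have "D s \<le> e / (1 - \<gamma>)"
    using D by (intro discounted_maximum_principle[OF P \<pi> discount]) (smt (verit))
  moreover have "- D s \<le> e / (1 - \<gamma>)"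
  proof (rule discounted_maximum_principle[OF P \<pi> discount])
    show "- D s \<le> e + \<gamma> * (\<Sum>s'\<in>UNIV. state_kernel P \<pi> s s' * - D s')" for s
      using D[of s] by (simp add: sum_negf)
  qed
  ultimately show ?thesis
    by linarith
qed

lemma V_fun_eq_state_kernel:
  assumes "0 < \<gamma>" "\<gamma> < 1" and P: "P \<in> kernels" and \<pi>: "\<pi> \<in> policies"
  shows "V_fun c \<gamma> P \<pi> s = (\<Sum>a\<in>UNIV. \<pi> $ s $ a * c s a) + \<gamma> * (\<Sum>s'\<in>UNIV. state_kernel P \<pi> s s' * V_fun c \<gamma> P \<pi> s')"
  unfolding V_fun_eq_Q_fun[OF assms(1,2) \<pi>, of _ _ s] Q_fun_eq_V_fun[OF assms(1,2) P] sum_state_kernel_mult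
  by (simp add: ring_distribs sum.distrib sum_distrib_left mult_ac)

text \<open>As functions of the initial state, both sides solve \<open>D = h + \<gamma> K D\<close>
  with the state kernel \<open>K\<close> of \<pi>'; the maximum principle with \<open>e = 0\<close>
  makes the solution unique. The value of a state indicator is the unnormalised occupancy.\<close>

lemma performance_difference:
  assumes discount: "0 < \<gamma>" "\<gamma> < 1" and P: "P \<in> kernels" and \<pi>: "\<pi> \<in> policies" and \<pi>': "\<pi>' \<in> policies"
  shows "V_fun c \<gamma> P \<pi>' s - V_fun c \<gamma> P \<pi> s =
    (\<Sum>s'\<in>UNIV. (\<Sum>a\<in>UNIV. (\<pi>' - \<pi>) $ s' $ a * Q_fun c \<gamma> P \<pi> s' a) * V_fun (\<lambda>t _. if t = s' then 1 else 0) \<gamma> P \<pi>' s)"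
proof -
  define h where "h s' = (\<Sum>a\<in>UNIV. (\<pi>' - \<pi>) $ s' $ a * Q_fun c \<gamma> P \<pi> s' a)" for s'
  let ?I = "\<lambda>s'. V_fun (\<lambda>t _. if t = s' then 1 else 0) \<gamma> P \<pi>'"
  let ?K = "state_kernel P \<pi>'"
  define D where "D s = V_fun c \<gamma> P \<pi>' s - V_fun c \<gamma> P \<pi> s" for s
  define W where "W s = (\<Sum>s'\<in>UNIV. h s' * ?I s' s)" for s
  have D: "D s = h s + \<gamma> * (\<Sum>s'\<in>UNIV. ?K s s' * D s')" for s
  proof -
    have Q: "Q_fun c \<gamma> P \<pi>' s a - Q_fun c \<gamma> P \<pi> s a = \<gamma> * (\<Sum>s'\<in>UNIV. P $ s $ a $ s' * D s')" for a
      by (simp add: Q_fun_eq_V_fun[OF discount P] D_def right_diff_distrib sum_subtractf)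
    have "D s = h s + (\<Sum>a\<in>UNIV. \<pi>' $ s $ a * (Q_fun c \<gamma> P \<pi>' s a - Q_fun c \<gamma> P \<pi> s a))"
      unfolding D_def h_def V_fun_eq_Q_fun[OF discount \<pi>] V_fun_eq_Q_fun[OF discount \<pi>']
      by (simp add: algebra_simps sum_subtractf)
    then show ?thesis
      unfolding Q sum_state_kernel_mult by (simp add: sum_distrib_left mult_ac)
  qed
  \<comment> \<open>The indicator values solve the equation with unit vectors as sources, so their
    superposition \<open>W\<close> has source \<open>h\<close>.\<close>
  have I: "?I s' s = (if s = s' then 1 else 0) + \<gamma> * (\<Sum>t\<in>UNIV. ?K s t * ?I s' t)" for s s'
    using V_fun_eq_state_kernel[OF discount P \<pi>', of "\<lambda>t _. if t = s' then 1 else 0" s]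
      policies_sum[OF \<pi>', of s]
    by (auto simp: if_distrib)
  have W: "W s = h s + \<gamma> * (\<Sum>t\<in>UNIV. ?K s t * W t)" for s
  proof -
    have "W s = (\<Sum>s'\<in>UNIV. h s' * ((if s = s' then 1 else 0) + \<gamma> * (\<Sum>t\<in>UNIV. ?K s t * ?I s' t)))"
      unfolding W_def by (subst I) (rule refl)
    also have "\<dots> = h s + \<gamma> * (\<Sum>s'\<in>UNIV. \<Sum>t\<in>UNIV. h s' * ?K s t * ?I s' t)"
      by (simp add: ring_distribs sum.distrib sum_distrib_left mult_ac if_distrib[where f="(*) _"] cong: if_cong)
    also have "(\<Sum>s'\<in>UNIV. \<Sum>t\<in>UNIV. h s' * ?K s t * ?I s' t) = (\<Sum>t\<in>UNIV. ?K s t * W t)"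
      unfolding W_def sum_distrib_left by (subst sum.swap) (simp add: mult_ac)
    finally show ?thesis .
  qed
  have "\<bar>D s - W s\<bar> \<le> 0 / (1 - \<gamma>)"
  proof (rule discounted_maximum_principle_abs[OF P \<pi>' discount])
    show "\<bar>D s - W s - \<gamma> * (\<Sum>t\<in>UNIV. ?K s t * (D t - W t))\<bar> \<le> 0" for s
      using D[of s] W[of s] by (simp add: right_diff_distrib sum_subtractf)
  qed
  then show ?thesis
    by (simp add: D_def W_def h_def)
qed

text \<open>The first factor bounds all values. \<open>CARD('a)\<close> accounts for a change of
  policy, \<open>CARD('s)\<close> for a change of kernel, and the last division comes from the
  maximum principle.\<close>

definition value_lip :: "('s::finite \<Rightarrow> 'a::finite \<Rightarrow> real) \<Rightarrow> real \<Rightarrow> real" where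
  "value_lip c \<gamma> = cost_bound c / (1 - \<gamma>) * (CARD('a) + CARD('s)) / (1 - \<gamma>)"

lemma abs_component_le_norm: "\<bar>z $ s $ a\<bar> \<le> norm z" for z :: "real ^ 'a ^ 's"
  using component_le_norm_cart[of "z $ s" a] Finite_Cartesian_Product.norm_nth_le[of z s] by simp

lemma abs_component_le_norm': "\<bar>z $ s $ a $ s'\<bar> \<le> norm z" for z :: "real ^ 's ^ 'a ^ 's"
  using abs_component_le_norm[of "z $ s" a s'] Finite_Cartesian_Product.norm_nth_le[of z s] by simp

text \<open>Subtracting the two Bellman equations leaves a discounted equation for the difference,
  with the state kernel of \<open>P'\<close> and \<pi>' and a source of first order in
  \<open>P - P'\<close> and \<open>\<pi> - \<pi>'\<close>.\<close>

lemma V_fun_lipschitz: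
  fixes c :: "'s::finite \<Rightarrow> 'a::finite \<Rightarrow> real"
  assumes discount: "0 < \<gamma>" "\<gamma> < 1" and P: "P \<in> kernels" "P' \<in> kernels" and \<pi>: "\<pi> \<in> policies" "\<pi>' \<in> policies"
  shows "\<bar>V_fun c \<gamma> P \<pi> s - V_fun c \<gamma> P' \<pi>' s\<bar> \<le> value_lip c \<gamma> * (norm (P - P') + norm (\<pi> - \<pi>'))"
proof -
  define B where "B = cost_bound c / (1 - \<gamma>)"
  have B: "0 \<le> B"
    using cost_bound_nonneg[of c] discount by (simp add: B_def)
  let ?N = "norm (P - P') + norm (\<pi> - \<pi>')"
  define D where "D s = V_fun c \<gamma> P \<pi> s - V_fun c \<gamma> P' \<pi>' s" for s
  define R where "R s a = (\<Sum>s'\<in>UNIV. (P - P') $ s $ a $ s' * V_fun c \<gamma> P \<pi> s')" for s a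
  have Q: "Q_fun c \<gamma> P \<pi> s a - Q_fun c \<gamma> P' \<pi>' s a = \<gamma> * R s a + \<gamma> * (\<Sum>s'\<in>UNIV. P' $ s $ a $ s' * D s')" for s a
    unfolding Q_fun_eq_V_fun[OF discount P(1)] Q_fun_eq_V_fun[OF discount P(2)] D_def R_def
    by (simp add: algebra_simps sum_subtractf)
  have D: "D s = (\<Sum>a\<in>UNIV. (\<pi> - \<pi>') $ s $ a * Q_fun c \<gamma> P \<pi> s a) + (\<Sum>a\<in>UNIV. \<pi>' $ s $ a * (\<gamma> * R s a))
      + \<gamma> * (\<Sum>s'\<in>UNIV. state_kernel P' \<pi>' s s' * D s')" for s
  proof -
    have "D s = (\<Sum>a\<in>UNIV. (\<pi> - \<pi>') $ s $ a * Q_fun c \<gamma> P \<pi> s a)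
        + (\<Sum>a\<in>UNIV. \<pi>' $ s $ a * (Q_fun c \<gamma> P \<pi> s a - Q_fun c \<gamma> P' \<pi>' s a))"
      unfolding D_def V_fun_eq_Q_fun[OF discount \<pi>(1)] V_fun_eq_Q_fun[OF discount \<pi>(2)]
      by (simp add: algebra_simps sum_subtractf)
    then show ?thesis
      unfolding Q sum_state_kernel_mult
      by (simp add: ring_distribs sum.distrib sum_distrib_left mult_ac)
  qed
  have R: "\<bar>R s a\<bar> \<le> CARD('s) * (?N * B)" for s a
  proof -
    have "\<bar>R s a\<bar> \<le> (\<Sum>s'\<in>(UNIV::'s set). ?N * B)"
      unfolding R_def
    proof (rule order_trans[OF sum_abs sum_mono])
      show "\<bar>(P - P') $ s $ a $ s' * V_fun c \<gamma> P \<pi> s'\<bar> \<le> ?N * B" for s'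
        unfolding abs_mult B_def
        using abs_component_le_norm'[of "P - P'" s a s'] abs_V_fun_le[OF discount, where c=c and P=P and \<pi>=\<pi> and s=s']
        by (intro mult_mono) (auto intro: add_increasing2)
    qed
    then show ?thesis
      by simp
  qed
  have "\<bar>D s - \<gamma> * (\<Sum>s'\<in>UNIV. state_kernel P' \<pi>' s s' * D s')\<bar> \<le> B * (CARD('a) + CARD('s)) * ?N" for s
  proof -
    have "\<bar>\<Sum>a\<in>UNIV. (\<pi> - \<pi>') $ s $ a * Q_fun c \<gamma> P \<pi> s a\<bar> \<le> (\<Sum>a\<in>(UNIV::'a set). ?N * B)"
    proof (rule order_trans[OF sum_abs sum_mono])
      show "\<bar>(\<pi> - \<pi>') $ s $ a * Q_fun c \<gamma> P \<pi> s a\<bar> \<le> ?N * B" for a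
        unfolding abs_mult B_def
        using abs_component_le_norm[of "\<pi> - \<pi>'" s a] abs_Q_fun_le[OF discount, where c=c and P=P and \<pi>=\<pi> and s=s and a=a]
        by (intro mult_mono) (auto intro: add_increasing)
    qed
    moreover have "\<bar>\<Sum>a\<in>UNIV. \<pi>' $ s $ a * (\<gamma> * R s a)\<bar> \<le> (\<Sum>a\<in>UNIV. \<pi>' $ s $ a * (CARD('s) * (?N * B)))"
    proof (rule order_trans[OF sum_abs sum_mono])
      fix a
      have "\<gamma> * \<bar>R s a\<bar> \<le> \<bar>R s a\<bar>"
        using discount by (simp add: mult_left_le_one_le)
      then have "\<gamma> * \<bar>R s a\<bar> \<le> CARD('s) * (?N * B)"
        using R[of s a] by linarith
      then show "\<bar>\<pi>' $ s $ a * (\<gamma> * R s a)\<bar> \<le> \<pi>' $ s $ a * (CARD('s) * (?N * B))"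
        using policies_nonneg[OF \<pi>(2), of s a] discount by (simp add: abs_mult mult_left_mono)
    qed
    moreover have "\<dots> = CARD('s) * (?N * B)"
      by (simp only: sum_distrib_right[symmetric] policies_sum[OF \<pi>(2)] mult_1)
    ultimately show ?thesis
      using D[of s] by (simp add: algebra_simps abs_le_iff)
  qed
  then have "\<bar>D s\<bar> \<le> B * (CARD('a) + CARD('s)) * ?N / (1 - \<gamma>)"
    by (rule discounted_maximum_principle_abs[OF P(2) \<pi>(2) discount])
  then show ?thesis
    by (simp add: D_def B_def value_lip_def)
qed

text \<open>The worst case \<open>u\<close> maximizes the next-step average of the robust value
  separately at each pair of state and action. Hence the robust value is a subsolution of the
  Bellman equation of \<open>u\<close>, and the maximum principle bounds it by the value under
  \<open>u\<close>: one \<open>u\<close> attains the suprema at all states.\<close>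

lemma
  assumes discount: "0 < \<gamma>" "\<gamma> < 1" and \<pi>: "\<pi> \<in> policies"
    and perturbed: "\<And>u. u \<in> U \<Longrightarrow> P\<^sub>N + u \<in> kernels"
    and u: "worst_case c \<gamma> P\<^sub>N U \<pi> u"
  shows V_robust_eq_V_fun: "V_robust c \<gamma> P\<^sub>N U \<pi> s = V_fun c \<gamma> (P\<^sub>N + u) \<pi> s"
    and V_fun_le_V_robust: "v \<in> U \<Longrightarrow> V_fun c \<gamma> (P\<^sub>N + v) \<pi> s \<le> V_robust c \<gamma> P\<^sub>N U \<pi> s"
proof -
  let ?W = "V_robust c \<gamma> P\<^sub>N U \<pi>"
  have uU: "u \<in> U"
    using u by (simp add: worst_case_def)
  have le: "V_fun c \<gamma> (P\<^sub>N + v) \<pi> s \<le> ?W s" if "v \<in> U" for v s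
    unfolding V_robust_def
  proof (rule cSUP_upper[OF that])
    show "bdd_above ((\<lambda>v. V_fun c \<gamma> (P\<^sub>N + v) \<pi> s) ` U)"
      by (rule bdd_aboveI2) (rule abs_le_D1[OF abs_V_fun_le[OF discount]])
  qed
  then show "v \<in> U \<Longrightarrow> V_fun c \<gamma> (P\<^sub>N + v) \<pi> s \<le> ?W s" .
  let ?K = "state_kernel (P\<^sub>N + u) \<pi>"
  have Bellman: "?W s \<le> (\<Sum>a\<in>UNIV. \<pi> $ s $ a * c s a) + \<gamma> * (\<Sum>s'\<in>UNIV. ?K s s' * ?W s')" for s
    unfolding V_robust_def[of _ _ _ _ _ s]
  proof (rule cSUP_least)
    show "U \<noteq> {}"
      using uU by auto
    fix v assume v: "v \<in> U"
    \<comment> \<open>For a competitor \<open>v\<close>, its value is first replaced by the larger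
      \<open>?W\<close>, then its kernel by that of \<open>u\<close>.\<close>
    have "(\<Sum>s'\<in>UNIV. state_kernel (P\<^sub>N + v) \<pi> s s' * V_fun c \<gamma> (P\<^sub>N + v) \<pi> s') \<le> (\<Sum>s'\<in>UNIV. state_kernel (P\<^sub>N + v) \<pi> s s' * ?W s')"
      using le[OF v] perturbed[OF v] \<pi>
      by (intro sum_mono mult_left_mono) (auto simp: state_kernel_def policies_nonneg intro!: sum_nonneg mult_nonneg_nonneg dest: kernels_nonneg)
    also have "\<dots> \<le> (\<Sum>s'\<in>UNIV. ?K s s' * ?W s')"
      unfolding sum_state_kernel_mult
    proof (rule sum_mono, rule mult_left_mono)
      show "(\<Sum>s'\<in>UNIV. (P\<^sub>N + v) $ s $ a $ s' * ?W s') \<le> (\<Sum>s'\<in>UNIV. (P\<^sub>N + u) $ s $ a $ s' * ?W s')" for a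
        using u v by (auto simp: worst_case_def is_arg_max_linorder sa_section_def)
    qed (use \<pi> policies_nonneg in auto)
    finally show "V_fun c \<gamma> (P\<^sub>N + v) \<pi> s \<le> (\<Sum>a\<in>UNIV. \<pi> $ s $ a * c s a) + \<gamma> * (\<Sum>s'\<in>UNIV. ?K s s' * ?W s')"
      using discount V_fun_eq_state_kernel[OF discount perturbed[OF v] \<pi>, of c s] by simp
  qed
  have "?W s - V_fun c \<gamma> (P\<^sub>N + u) \<pi> s \<le> 0 / (1 - \<gamma>)"
  proof (rule discounted_maximum_principle[OF perturbed[OF uU] \<pi> discount])
    show "?W s - V_fun c \<gamma> (P\<^sub>N + u) \<pi> s \<le> 0 + \<gamma> * (\<Sum>s'\<in>UNIV. ?K s s' * (?W s' - V_fun c \<gamma> (P\<^sub>N + u) \<pi> s'))" for s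
      using Bellman[of s] V_fun_eq_state_kernel[OF discount perturbed[OF uU] \<pi>, of c s]
      by (simp add: right_diff_distrib sum_subtractf)
  qed
  then show "?W s = V_fun c \<gamma> (P\<^sub>N + u) \<pi> s"
    using le[OF uU, of s] by simp
qed

section \<open>The objective for a fixed kernel\<close>

abbreviation state_indicator :: "'s \<Rightarrow> 's \<Rightarrow> 'a \<Rightarrow> real" where
  "state_indicator s \<equiv> (\<lambda>t _. if t = s then 1 else 0)"

definition objective ::
  "('s \<Rightarrow> 'a \<Rightarrow> real) \<Rightarrow> real \<Rightarrow> 's pmf \<Rightarrow> real ^ 's ^ 'a ^ 's \<Rightarrow> real ^ 'a ^ 's \<Rightarrow> real" where
  "objective c \<gamma> \<rho> P \<pi> = measure_pmf.expectation \<rho> (\<lambda>s. V_fun c \<gamma> P \<pi> s)"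

definition policy_gradient ::
  "('s \<Rightarrow> 'a \<Rightarrow> real) \<Rightarrow> real \<Rightarrow> 's pmf \<Rightarrow> real ^ 's ^ 'a ^ 's \<Rightarrow> real ^ 'a ^ 's \<Rightarrow> real ^ 'a ^ 's" where
  "policy_gradient c \<gamma> \<rho> P \<pi> = (\<chi> s a. 1 / (1 - \<gamma>) * occupancy_from \<gamma> P \<pi> \<rho> s * Q_fun c \<gamma> P \<pi> s a)"

lemma policy_gradient_nth:
  fixes c :: "'s::finite \<Rightarrow> 'a::finite \<Rightarrow> real"
  assumes "0 < \<gamma>" "\<gamma> < 1"
  shows "policy_gradient c \<gamma> \<rho> P \<pi> $ s $ a =
    measure_pmf.expectation \<rho> (V_fun (state_indicator s) \<gamma> P \<pi>) * Q_fun c \<gamma> P \<pi> s a"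
  using assms
  by (simp add: policy_gradient_def occupancy_from_def occupancy_eq_V_fun)

text \<open>By \<open>performance_difference\<close>, the increment weights \<open>h\<close> by the
  occupancies of \<pi>', while the gradient weights it by those of \<pi>. The error is
  \<open>h\<close> times a difference of occupancies; both are of first order in
  \<open>\<pi>' - \<pi>\<close>, with constants independent of the kernel.\<close>

lemma objective_taylor_bound:
  fixes c :: "'s::finite \<Rightarrow> 'a::finite \<Rightarrow> real"
  assumes discount: "0 < \<gamma>" "\<gamma> < 1"
  obtains K where "0 \<le> K" "\<And>P \<pi> \<pi>'. P \<in> kernels \<Longrightarrow> \<pi> \<in> policies \<Longrightarrow> \<pi>' \<in> policies \<Longrightarrow>
    \<bar>objective c \<gamma> \<rho> P \<pi>' - objective c \<gamma> \<rho> P \<pi> - policy_gradient c \<gamma> \<rho> P \<pi> \<bullet> (\<pi>' - \<pi>)\<bar> \<le> K * (norm (\<pi>' - \<pi>))\<^sup>2"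
proof
  define B where "B = cost_bound c / (1 - \<gamma>)"
  have B: "0 \<le> B"
    using cost_bound_nonneg[of c] discount by (simp add: B_def)
  define L where "L s' = value_lip (state_indicator s' :: 's \<Rightarrow> 'a \<Rightarrow> real) \<gamma>" for s'
  have L: "0 \<le> L s'" for s'
    using discount by (simp add: L_def value_lip_def cost_bound_nonneg)
  let ?K = "CARD('a) * B * (\<Sum>s'\<in>UNIV. L s')"
  show "0 \<le> ?K"
    using B L by (simp add: sum_nonneg)
  fix P :: "real ^ 's ^ 'a ^ 's" and \<pi> \<pi>' :: "real ^ 'a ^ 's"
  assume P: "P \<in> kernels" and \<pi>: "\<pi> \<in> policies" "\<pi>' \<in> policies"
  let ?\<delta> = "\<pi>' - \<pi>"
  let ?I = "\<lambda>s'. V_fun (state_indicator s' :: 's \<Rightarrow> 'a \<Rightarrow> real) \<gamma> P"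
  define h where "h s' = (\<Sum>a\<in>UNIV. ?\<delta> $ s' $ a * Q_fun c \<gamma> P \<pi> s' a)" for s'
  have diff: "objective c \<gamma> \<rho> P \<pi>' - objective c \<gamma> \<rho> P \<pi> = measure_pmf.expectation \<rho> (\<lambda>s. \<Sum>s'\<in>UNIV. h s' * ?I s' \<pi>' s)"
    unfolding objective_def h_def performance_difference[OF discount P \<pi>, symmetric]
    by (subst Bochner_Integration.integral_diff) (auto intro: integrable_measure_pmf_finite)
  have grad: "policy_gradient c \<gamma> \<rho> P \<pi> \<bullet> ?\<delta> = measure_pmf.expectation \<rho> (\<lambda>s. \<Sum>s'\<in>UNIV. h s' * ?I s' \<pi> s)"
  proof -
    have "policy_gradient c \<gamma> \<rho> P \<pi> \<bullet> ?\<delta> = (\<Sum>s'\<in>UNIV. h s' * measure_pmf.expectation \<rho> (?I s' \<pi>))"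
      by (simp add: inner_vec_def policy_gradient_nth[OF discount] h_def sum_distrib_left mult_ac)
    also have "\<dots> = measure_pmf.expectation \<rho> (\<lambda>s. \<Sum>s'\<in>UNIV. h s' * ?I s' \<pi> s)"
      by (subst Bochner_Integration.integral_sum) (auto intro: integrable_measure_pmf_finite)
    finally show ?thesis .
  qed
  have "\<bar>measure_pmf.expectation \<rho> (\<lambda>s. \<Sum>s'\<in>UNIV. h s' * (?I s' \<pi>' s - ?I s' \<pi> s))\<bar> \<le> ?K * (norm ?\<delta>)\<^sup>2"
  proof (rule abs_expectation_le)
    fix s
    have h: "\<bar>h s'\<bar> \<le> CARD('a) * B * norm ?\<delta>" for s'
    proof -
      have "\<bar>h s'\<bar> \<le> (\<Sum>a\<in>(UNIV::'a set). norm ?\<delta> * B)"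
        unfolding h_def
      proof (rule order_trans[OF sum_abs sum_mono])
        show "\<bar>?\<delta> $ s' $ a * Q_fun c \<gamma> P \<pi> s' a\<bar> \<le> norm ?\<delta> * B" for a
          unfolding abs_mult B_def
          using abs_component_le_norm[of ?\<delta> s' a] abs_Q_fun_le[OF discount, where c=c and P=P and \<pi>=\<pi> and s=s' and a=a]
          by (intro mult_mono) auto
      qed
      then show ?thesis
        by (simp add: mult_ac)
    qed
    have "\<bar>?I s' \<pi>' s - ?I s' \<pi> s\<bar> \<le> L s' * norm ?\<delta>" for s'
      using V_fun_lipschitz[OF discount P P \<pi>(2,1), of "state_indicator s'" s] by (simp add: L_def)
    then have "\<bar>h s' * (?I s' \<pi>' s - ?I s' \<pi> s)\<bar> \<le> CARD('a) * B * norm ?\<delta> * (L s' * norm ?\<delta>)" for s'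
      unfolding abs_mult using h[of s'] B by (intro mult_mono) auto
    then have "\<bar>\<Sum>s'\<in>UNIV. h s' * (?I s' \<pi>' s - ?I s' \<pi> s)\<bar> \<le> (\<Sum>s'\<in>UNIV. CARD('a) * B * norm ?\<delta> * (L s' * norm ?\<delta>))"
      by (intro order_trans[OF sum_abs sum_mono])
    also have "\<dots> = ?K * (norm ?\<delta>)\<^sup>2"
      unfolding sum_distrib_left sum_distrib_right by (rule sum.cong) (auto simp: power2_eq_square)
    finally show "\<bar>\<Sum>s'\<in>UNIV. h s' * (?I s' \<pi>' s - ?I s' \<pi> s)\<bar> \<le> ?K * (norm ?\<delta>)\<^sup>2" .
  qed
  then show "\<bar>objective c \<gamma> \<rho> P \<pi>' - objective c \<gamma> \<rho> P \<pi> - policy_gradient c \<gamma> \<rho> P \<pi> \<bullet> ?\<delta>\<bar> \<le> ?K * (norm ?\<delta>)\<^sup>2"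
    unfolding diff grad
    by (subst Bochner_Integration.integral_diff[symmetric])
      (auto intro: integrable_measure_pmf_finite simp: sum_subtractf right_diff_distrib)
qed

lemma norm_policy_gradient_le:
  fixes c :: "'s::finite \<Rightarrow> 'a::finite \<Rightarrow> real"
  assumes discount: "0 < \<gamma>" "\<gamma> < 1"
  obtains L where "\<And>P \<pi>. norm (policy_gradient c \<gamma> \<rho> P \<pi>) \<le> L"
proof
  fix P and \<pi> :: "real ^ 'a ^ 's"
  let ?b = "\<lambda>s. cost_bound (state_indicator s :: 's \<Rightarrow> 'a \<Rightarrow> real) / (1 - \<gamma>) * (cost_bound c / (1 - \<gamma>))"
  have entry: "\<bar>policy_gradient c \<gamma> \<rho> P \<pi> $ s $ a\<bar> \<le> ?b s" for s a
    unfolding policy_gradient_nth[OF discount] abs_mult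
    using discount
    by (intro mult_mono abs_expectation_le abs_V_fun_le[OF discount] abs_Q_fun_le[OF discount])
      (auto simp: cost_bound_nonneg)
  have "norm (policy_gradient c \<gamma> \<rho> P \<pi>) \<le> (\<Sum>s\<in>UNIV. norm (policy_gradient c \<gamma> \<rho> P \<pi> $ s))"
    unfolding norm_vec_def by (rule L2_set_le_sum) simp
  also have "\<dots> \<le> (\<Sum>s\<in>UNIV. \<Sum>a\<in>(UNIV::'a set). ?b s)"
    by (intro sum_mono order_trans[OF norm_le_l1_cart] entry)
  finally show "norm (policy_gradient c \<gamma> \<rho> P \<pi>) \<le> (\<Sum>s\<in>UNIV. \<Sum>a\<in>(UNIV::'a set). ?b s)" .
qed

section \<open>Continuity in the uncertainty, and the dimension of the policy set\<close>

lemma continuous_on_V_fun_perturbation: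
  fixes c :: "'s::finite \<Rightarrow> 'a::finite \<Rightarrow> real"
  assumes discount: "0 < \<gamma>" "\<gamma> < 1" and \<pi>: "\<pi> \<in> policies" and perturbed: "\<And>u. u \<in> U \<Longrightarrow> P + u \<in> kernels"
  shows "continuous_on U (\<lambda>u. V_fun c \<gamma> (P + u) \<pi> s)"
proof (rule lipschitz_on_continuous_on)
  show "(value_lip c \<gamma>)-lipschitz_on U (\<lambda>u. V_fun c \<gamma> (P + u) \<pi> s)"
  proof (rule lipschitz_onI)
    show "0 \<le> value_lip c \<gamma>"
      using cost_bound_nonneg[of c] discount by (simp add: value_lip_def)
    show "dist (V_fun c \<gamma> (P + u) \<pi> s) (V_fun c \<gamma> (P + v) \<pi> s) \<le> value_lip c \<gamma> * dist u v" if "u \<in> U" "v \<in> U" for u v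
      using V_fun_lipschitz[OF discount perturbed[OF that(1)] perturbed[OF that(2)] \<pi> \<pi>, of c s]
      by (simp add: dist_real_def dist_norm)
  qed
qed

lemma continuous_on_objective_perturbation:
  fixes c :: "'s::finite \<Rightarrow> 'a::finite \<Rightarrow> real"
  assumes "0 < \<gamma>" "\<gamma> < 1" "\<pi> \<in> policies" "\<And>u. u \<in> U \<Longrightarrow> P + u \<in> kernels"
  shows "continuous_on U (\<lambda>u. objective c \<gamma> \<rho> (P + u) \<pi>)"
  unfolding objective_def integral_measure_pmf_real[of UNIV, OF finite UNIV_I]
  by (intro continuous_intros continuous_on_V_fun_perturbation assms)

lemma continuous_on_policy_gradient_perturbation:
  fixes c :: "'s::finite \<Rightarrow> 'a::finite \<Rightarrow> real"
  assumes "0 < \<gamma>" "\<gamma> < 1" "\<pi> \<in> policies" and perturbed: "\<And>u. u \<in> U \<Longrightarrow> P + u \<in> kernels"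
  shows "continuous_on U (\<lambda>u. policy_gradient c \<gamma> \<rho> (P + u) \<pi>)"
proof -
  have Q: "continuous_on U (\<lambda>u. Q_fun c \<gamma> (P + u) \<pi> s a)" for s a
  proof (rule continuous_on_cong[THEN iffD1, OF refl])
    show "continuous_on U (\<lambda>u. c s a + \<gamma> * (\<Sum>s'\<in>UNIV. (P + u) $ s $ a $ s' * V_fun c \<gamma> (P + u) \<pi> s'))"
      by (intro continuous_intros continuous_on_V_fun_perturbation assms)
  qed (simp add: Q_fun_eq_V_fun[OF assms(1,2) perturbed])
  have "continuous_on U (\<lambda>u. \<chi> s a. policy_gradient c \<gamma> \<rho> (P + u) \<pi> $ s $ a)"
    unfolding policy_gradient_nth[OF assms(1,2)] integral_measure_pmf_real[of UNIV, OF finite UNIV_I]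
    by (intro continuous_intros continuous_on_V_fun_perturbation Q assms)
  then show ?thesis
    by simp
qed

text \<open>Differences of policies lie in this space, whose dimension becomes that of the Hausdorff
  measure. It is the orthogonal complement of the \<open>CARD('s)\<close> pairwise orthogonal row
  indicators \<open>w s\<close>.\<close>

lemma dim_zero_row_sums:
  "dim {z :: real ^ 'a::finite ^ 's::finite. \<forall>s. (\<Sum>a\<in>UNIV. z $ s $ a) = 0} = (CARD('a) - 1) * CARD('s)"
proof -
  define w :: "'s \<Rightarrow> real ^ 'a ^ 's" where "w s = axis s (\<chi> a. 1)" for s
  have w_nth: "w s $ t $ a = (if t = s then 1 else 0)" for s t a
    by (simp add: w_def axis_def)
  have inner_w: "w s \<bullet> z = (\<Sum>a\<in>UNIV. z $ s $ a)" for s z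
  proof -
    have "w s $ t \<bullet> z $ t = (if t = s then \<Sum>a\<in>UNIV. z $ s $ a else 0)" for t
      by (simp add: inner_vec_def w_nth)
    then show ?thesis
      by (subst inner_vec_def) simp
  qed
  have w_eq_iff: "w s = w t \<longleftrightarrow> s = t" for s t
    using w_nth[of s s] w_nth[of t s] by (metis zero_neq_one)
  have card: "card (range w) = CARD('s)"
    by (rule card_image) (simp add: inj_on_def w_eq_iff)
  have "orthogonal (w s) (w t)" if "s \<noteq> t" for s t
    using that by (simp add: orthogonal_def inner_w w_nth)
  then have orth: "pairwise orthogonal (range w)"
    by (auto simp: pairwise_def w_eq_iff)
  have "w s \<noteq> 0" for s
    using w_nth[of s s] by (metis zero_index zero_neq_one)
  then have "0 \<notin> range w"
    by force
  then have "independent (range w)"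
    using orth by (rule pairwise_orthogonal_independent[rotated])
  then have "dim (range w) = CARD('s)"
    using card dim_eq_card_independent by fastforce
  moreover have "{y \<in> UNIV. \<forall>x\<in>span (range w). orthogonal x y} = {z. \<forall>s. (\<Sum>a\<in>UNIV. z $ s $ a) = 0}"
  proof -
    have "(\<forall>x\<in>span (range w). orthogonal x y) \<longleftrightarrow> (\<forall>s. orthogonal (w s) y)" for y
    proof
      assume w: "\<forall>s. orthogonal (w s) y"
      have "orthogonal y x" if "x \<in> span (range w)" for x
        using that by (rule orthogonal_to_span) (use w in \<open>auto simp: orthogonal_commute\<close>)
      then show "\<forall>x\<in>span (range w). orthogonal x y"
        by (simp add: orthogonal_commute)
    qed (simp add: span_base)
    then show ?thesis
      by (simp add: orthogonal_def inner_w)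
  qed
  ultimately have "dim {z :: real ^ 'a ^ 's. \<forall>s. (\<Sum>a\<in>UNIV. z $ s $ a) = 0} + CARD('s) = CARD('a) * CARD('s)"
    using dim_subspace_orthogonal_to_vectors[of "span (range w)" UNIV] by (simp add: dim_UNIV mult.commute)
  then show ?thesis
    by (simp add: diff_mult_distrib)
qed

section \<open>The robust objective\<close>

theorem lemma2p4:
  fixes c :: "'s::finite \<Rightarrow> 'a::finite \<Rightarrow> real"
    and \<gamma> :: real
    and P\<^sub>N :: "real ^ 's ^ 'a ^ 's"
    and U :: "(real ^ 's ^ 'a ^ 's) set"
    and u_of :: "real ^ 'a ^ 's \<Rightarrow> real ^ 's ^ 'a ^ 's"
    and \<rho> :: "'s pmf"
  defines "f \<equiv> (\<lambda>\<pi>. measure_pmf.expectation \<rho> (\<lambda>s. V_robust c \<gamma> P\<^sub>N U \<pi> s))"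
  assumes cost: "\<And>s a. 0 < c s a \<and> c s a \<le> 1"
    and discount: "0 < \<gamma>" "\<gamma> < 1"
    and nominal: "P\<^sub>N \<in> kernels"
    and uncertainty: "U \<noteq> {}" "compact U" "sa_rectangular U"
    and perturbed: "\<And>u. u \<in> U \<Longrightarrow> P\<^sub>N + u \<in> kernels"
    and selection: "\<And>\<pi>. \<pi> \<in> policies \<Longrightarrow> worst_case c \<gamma> P\<^sub>N U \<pi> (u_of \<pi>)"
  shows "\<exists>N. hausdorff_measure ((CARD('a) - 1) * CARD('s)) N = 0 \<and>
    (\<forall>\<pi> \<in> rel_interior policies - N.
      has_policy_gradient f
        (\<chi> s a. 1 / (1 - \<gamma>) * occupancy_from \<gamma> (P\<^sub>N + u_of \<pi>) \<pi> \<rho> s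
                  * Q_fun c \<gamma> (P\<^sub>N + u_of \<pi>) \<pi> s a) \<pi>)"
proof -
  let ?F = "\<lambda>u. objective c \<gamma> \<rho> (P\<^sub>N + u)" and ?G = "\<lambda>u. policy_gradient c \<gamma> \<rho> (P\<^sub>N + u)"
  let ?T = "{z :: real ^ 'a ^ 's. \<forall>s. (\<Sum>a\<in>UNIV. z $ s $ a) = 0}"
  obtain K where K: "0 \<le> K" "\<And>P \<pi> \<pi>'. P \<in> kernels \<Longrightarrow> \<pi> \<in> policies \<Longrightarrow> \<pi>' \<in> policies \<Longrightarrow>
      \<bar>objective c \<gamma> \<rho> P \<pi>' - objective c \<gamma> \<rho> P \<pi> - policy_gradient c \<gamma> \<rho> P \<pi> \<bullet> (\<pi>' - \<pi>)\<bar> \<le> K * (norm (\<pi>' - \<pi>))\<^sup>2"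
    using objective_taylor_bound[OF discount] by blast
  obtain L where L: "\<And>P \<pi>. norm (policy_gradient c \<gamma> \<rho> P \<pi>) \<le> L"
    using norm_policy_gradient_le[OF discount] by blast
  have u_of: "u_of \<pi> \<in> U" if "\<pi> \<in> policies" for \<pi>
    using selection[OF that] by (simp add: worst_case_def)
  \<comment> \<open>The worst case attains \<open>V_robust\<close> at every state at once, so the
    expected robust value is the objective of a single kernel.\<close>
  have f_eq: "f \<pi> = ?F (u_of \<pi>) \<pi>" if "\<pi> \<in> policies" for \<pi>
    unfolding f_def objective_def
    by (intro arg_cong[where f="measure_pmf.expectation \<rho>"] ext V_robust_eq_V_fun[OF discount that perturbed selection[OF that]])
  have F_le: "?F u \<pi> \<le> ?F (u_of \<pi>) \<pi>" if "u \<in> U" "\<pi> \<in> policies" for u \<pi>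
    unfolding objective_def
  proof (intro integral_mono integrable_measure_pmf_finite)
    show "V_fun c \<gamma> (P\<^sub>N + u) \<pi> s \<le> V_fun c \<gamma> (P\<^sub>N + u_of \<pi>) \<pi> s" for s
      using V_fun_le_V_robust[OF discount that(2) perturbed selection[OF that(2)] that(1)]
      by (simp add: V_robust_eq_V_fun[OF discount that(2) perturbed selection[OF that(2)]])
  qed auto
  \<comment> \<open>Policies are the points, uncertainties the parameters, and \<open>u_of\<close>
    selects the maximizers.\<close>
  interpret smooth_maximum ?F ?G U policies u_of K L
  proof
    show "0 \<le> L"
      using L order_trans[OF norm_ge_zero] by blast
    show "continuous_on U (\<lambda>u. ?F u \<pi>)" "continuous_on U (\<lambda>u. ?G u \<pi>)" if "\<pi> \<in> policies" for \<pi>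
      using that by (auto intro!: perturbed
        continuous_on_objective_perturbation[OF discount] continuous_on_policy_gradient_perturbation[OF discount])
  qed (use uncertainty(2) K L perturbed u_of F_le in auto)
  have "subspace ?T"
    by (auto simp: subspace_def sum.distrib sum_distrib_left[symmetric])
  moreover have "\<pi>' - \<pi> \<in> ?T" if "\<pi> \<in> policies" "\<pi>' \<in> policies" for \<pi> \<pi>'
    using that by (simp add: sum_subtractf policies_sum)
  ultimately obtain N where N: "hausdorff_measure (dim ?T) N = 0"
    "\<And>\<pi>. \<pi> \<in> policies - N \<Longrightarrow> ((\<lambda>\<delta>. \<bar>?F (u_of (\<pi> + \<delta>)) (\<pi> + \<delta>) - ?F (u_of \<pi>) \<pi> - ?G (u_of \<pi>) \<pi> \<bullet> \<delta>\<bar> / norm \<delta>) \<longlongrightarrow> 0)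
      (at 0 within {\<delta>. \<pi> + \<delta> \<in> policies})"
    using differentiable_off_null_set by blast
  have "has_policy_gradient f (?G (u_of \<pi>) \<pi>) \<pi>" if \<pi>: "\<pi> \<in> policies - N" for \<pi>
    unfolding has_policy_gradient_def
  proof (rule Lim_transform_eventually[OF N(2)[OF \<pi>]])
    \<comment> \<open>Within the filter both \<pi> and \<open>\<pi> + \<delta>\<close> are policies,
      so \<open>f_eq\<close> rewrites both values of \<open>f\<close>.\<close>
    show "\<forall>\<^sub>F \<delta> in at 0 within {\<delta>. \<pi> + \<delta> \<in> policies}.
        \<bar>?F (u_of (\<pi> + \<delta>)) (\<pi> + \<delta>) - ?F (u_of \<pi>) \<pi> - ?G (u_of \<pi>) \<pi> \<bullet> \<delta>\<bar> / norm \<delta> =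
        \<bar>f (\<pi> + \<delta>) - f \<pi> - ?G (u_of \<pi>) \<pi> \<bullet> \<delta>\<bar> / norm \<delta>"
      using \<pi> f_eq by (auto simp: eventually_at intro!: exI[of _ 1])
  qed
  then show ?thesis
    using N(1) rel_interior_subset[of policies]
    unfolding policy_gradient_def dim_zero_row_sums by (intro exI[of _ N]) auto
qed

end
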